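(* Let $(R,\mathfrak{m})$ be a $1$-dimensional Cohen-Macaulay local ring with infinite residue field. Then, for any minimal reduction $I$ of $\mathfrak{m}$, $$n_2(I)\leq n_3(I)=n_1(I)=\mathrm{r}(\mathfrak{m}).$$
   Context: All rings are commutative, Noetherian and unital; a local ring is such a ring with a unique maximal ideal $\mathfrak{m}$. For ideals $A,B$ and an element $x$ of $R$, $A:B=\{r\in R\mid rB\subseteq A\}$ and $A:x=A:(x)$. Convention: $\mathfrak{m}^0=R$. Let $(R,\mathfrak{m})$ be a local ring with infinite residue field and let $J$ be an ideal of $R$. - $J$ is $\mathfrak{m}$-full if $J\mathfrak{m}:x=J$ for some element $x\in\mathfrak{m}\setminus\mathfrak{m}^2$. - $J$ is full if $J:x=J:\mathfrak{m}$ for some element $x\in\mathfrak{m}\setminus\mathfrak{m}^2$. - $J$ is weakly $\mathfrak{m}$-full if $J\mathfrak{m}:\mathfrak{m}=J$. If moreover $\operatorname{depth} R>0$ (i.e. $\mathfrak{m}$ contains a non-zero-divisor of $R$), then for an ideal $I$ of $R$ set - $n_1(I)=\min\{t\geq 0\mid I\mathfrak{m}^n \text{ is } \mathfrak{m}\text{-full for all } n\geq t\}$; - $n_2(I)=\min\{t\geq 0\mid I\mathfrak{m}^n \text{ is full for all } n\geq t\}$; - $n_3(I)=\min\{t\geq 0\mid I\mathfrak{m}^n \text{ is weakly } \mathfrak{m}\text{-full for all } n\geq t\}$. It is known (H. Dao) that these minima exist. An ideal $I\subseteq\mathfrak{m}$ is a reduction of $\mathfrak{m}$ if $I\mathfrak{m}^r=\mathfrak{m}^{r+1}$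 for some integer $r\geq 0$; it is a minimal reduction if it is minimal, with respect to inclusion, among the reductions of $\mathfrak{m}$. For a reduction $I$ of $\mathfrak{m}$, $\mathrm{r}_I(\mathfrak{m})=\min\{m\geq 0\mid I\mathfrak{m}^m=\mathfrak{m}^{m+1}\}$. The (absolute) reduction number of $\mathfrak{m}$ is $\mathrm{r}(\mathfrak{m})=\min\{\mathrm{r}_I(\mathfrak{m})\mid I\text{ is a minimal reduction of }\mathfrak{m}\}$. *)

theory Defs
  imports "HOL-Algebra.Algebra" "HOL-Library.Extended_Nat"
begin

section \<open>Noetherian local rings, Krull dimension, depth\<close>

locale noetherian_local_ring = noetherian_ring R + cring R
  for R :: "('a, 'b) ring_scheme" (structure) and \<mm> :: "'a set" +
  assumes maximal: "maximalideal \<mm> R"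
    and maximal_unique: "maximalideal M R \<Longrightarrow> M = \<mm>"

definition infinite_residue_field :: "('a, 'b) ring_scheme \<Rightarrow> 'a set \<Rightarrow> bool"
  where "infinite_residue_field R \<mm> \<longleftrightarrow> infinite (carrier (R Quot \<mm>))"

text \<open>A chain of length \<open>n\<close> has \<open>n + 1\<close> members. The value is \<open>\<infinity>\<close> if the lengths are
  unbounded; the zero ring (never local) gets \<open>0\<close>.\<close>

definition krull_dim :: "('a, 'b) ring_scheme \<Rightarrow> enat"
  where "krull_dim R = Sup {enat n | n.
    \<exists>P. (\<forall>i\<le>n. primeideal (P i) R) \<and> (\<forall>i<n. P i \<subset> P (Suc i))}"

definition nonzerodivisor :: "('a, 'b) ring_scheme \<Rightarrow> 'a \<Rightarrow> bool"
  where "nonzerodivisor R x \<longleftrightarrow>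
    x \<in> carrier R \<and> (\<forall>y\<in>carrier R. x \<otimes>\<^bsub>R\<^esub> y = \<zero>\<^bsub>R\<^esub> \<longrightarrow> y = \<zero>\<^bsub>R\<^esub>)"

definition regular_sequence :: "('a, 'b) ring_scheme \<Rightarrow> 'a list \<Rightarrow> bool"
  where "regular_sequence R xs \<longleftrightarrow>
    set xs \<subseteq> carrier R \<and>
    (\<forall>i<length xs. nonzerodivisor (R Quot (Idl\<^bsub>R\<^esub> (set (take i xs))))
                     ((Idl\<^bsub>R\<^esub> (set (take i xs))) +>\<^bsub>R\<^esub> (xs ! i))) \<and>
    Idl\<^bsub>R\<^esub> (set xs) \<noteq> carrier R"

definition depth :: "('a, 'b) ring_scheme \<Rightarrow> 'a set \<Rightarrow> enat"
  where "depth R \<mm> = Sup {enat (length xs) | xs. set xs \<subseteq> \<mm> \<and> regular_sequence R xs}"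

definition cohen_macaulay_local_ring :: "('a, 'b) ring_scheme \<Rightarrow> 'a set \<Rightarrow> bool"
  where "cohen_macaulay_local_ring R \<mm> \<longleftrightarrow>
    noetherian_local_ring R \<mm> \<and> depth R \<mm> = krull_dim R"


section \<open>Colon ideals and fullness\<close>

text \<open>Powers are taken in the library's semiring of ideals, whose unit is the ring itself;
  hence the zeroth power of an ideal is \<open>carrier R\<close>.\<close>

abbreviation ideal_pow :: "('a, 'b) ring_scheme \<Rightarrow> 'a set \<Rightarrow> nat \<Rightarrow> 'a set"
  where "ideal_pow R A n \<equiv> A [^]\<^bsub>ideals_set R\<^esub> n"

definition colon :: "('a, 'b) ring_scheme \<Rightarrow> 'a set \<Rightarrow> 'a set \<Rightarrow> 'a set"
  where "colon R A B = {r \<in> carrier R. \<forall>b\<in>B. r \<otimes>\<^bsub>R\<^esub> b \<in> A}"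

definition m_full :: "('a, 'b) ring_scheme \<Rightarrow> 'a set \<Rightarrow> 'a set \<Rightarrow> bool"
  where "m_full R \<mm> J \<longleftrightarrow>
    (\<exists>x \<in> \<mm> - ideal_pow R \<mm> 2. colon R (J \<cdot>\<^bsub>R\<^esub> \<mm>) (PIdl\<^bsub>R\<^esub> x) = J)"

definition full :: "('a, 'b) ring_scheme \<Rightarrow> 'a set \<Rightarrow> 'a set \<Rightarrow> bool"
  where "full R \<mm> J \<longleftrightarrow>
    (\<exists>x \<in> \<mm> - ideal_pow R \<mm> 2. colon R J (PIdl\<^bsub>R\<^esub> x) = colon R J \<mm>)"

definition weakly_m_full :: "('a, 'b) ring_scheme \<Rightarrow> 'a set \<Rightarrow> 'a set \<Rightarrow> bool"
  where "weakly_m_full R \<mm> J \<longleftrightarrow> colon R (J \<cdot>\<^bsub>R\<^esub> \<mm>) \<mm> = J"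

definition n1 :: "('a, 'b) ring_scheme \<Rightarrow> 'a set \<Rightarrow> 'a set \<Rightarrow> nat"
  where "n1 R \<mm> I = (LEAST t. \<forall>n\<ge>t. m_full R \<mm> (I \<cdot>\<^bsub>R\<^esub> ideal_pow R \<mm> n))"

definition n2 :: "('a, 'b) ring_scheme \<Rightarrow> 'a set \<Rightarrow> 'a set \<Rightarrow> nat"
  where "n2 R \<mm> I = (LEAST t. \<forall>n\<ge>t. full R \<mm> (I \<cdot>\<^bsub>R\<^esub> ideal_pow R \<mm> n))"

definition n3 :: "('a, 'b) ring_scheme \<Rightarrow> 'a set \<Rightarrow> 'a set \<Rightarrow> nat"
  where "n3 R \<mm> I = (LEAST t. \<forall>n\<ge>t. weakly_m_full R \<mm> (I \<cdot>\<^bsub>R\<^esub> ideal_pow R \<mm> n))"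


section \<open>Reductions of the maximal ideal\<close>

definition reduction :: "('a, 'b) ring_scheme \<Rightarrow> 'a set \<Rightarrow> 'a set \<Rightarrow> bool"
  where "reduction R \<mm> I \<longleftrightarrow>
    ideal I R \<and> I \<subseteq> \<mm> \<and> (\<exists>r. I \<cdot>\<^bsub>R\<^esub> ideal_pow R \<mm> r = ideal_pow R \<mm> (r + 1))"

definition minimal_reduction :: "('a, 'b) ring_scheme \<Rightarrow> 'a set \<Rightarrow> 'a set \<Rightarrow> bool"
  where "minimal_reduction R \<mm> I \<longleftrightarrow>
    reduction R \<mm> I \<and> (\<forall>K. reduction R \<mm> K \<longrightarrow> K \<subseteq> I \<longrightarrow> K = I)"

definition reduction_number_wrt :: "('a, 'b) ring_scheme \<Rightarrow> 'a set \<Rightarrow> 'a set \<Rightarrow> nat"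
  where "reduction_number_wrt R \<mm> I =
    (LEAST k. I \<cdot>\<^bsub>R\<^esub> ideal_pow R \<mm> k = ideal_pow R \<mm> (k + 1))"

definition reduction_number :: "('a, 'b) ring_scheme \<Rightarrow> 'a set \<Rightarrow> nat"
  where "reduction_number R \<mm> =
    (LEAST k. \<exists>I. minimal_reduction R \<mm> I \<and> k = reduction_number_wrt R \<mm> I)"

end

theory Submission
  imports Defs
begin

text \<open>A minimal reduction \<open>I\<close> of \<open>\<mm>\<close> is generated by one non-zero-divisor \<open>x\<close>. Indeed, if
  \<open>w \<in> \<mm>\<close> is a non-zero-divisor, then \<open>R/w\<close> has some finite length \<open>e\<close>, because all primes
  containing \<open>w\<close> are maximal in dimension one, and \<open>I\<^sup>n/wI\<^sup>n\<close> has length at most \<open>e\<close> for every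
  \<open>n\<close>. For \<open>n > e\<close> the one-element case of the theorem of Eakin and Sathaye together with
  Nakayama's lemma gives \<open>x \<in> I\<close> with \<open>x I\<^sup>n\<^sup>-\<^sup>1 = I\<^sup>n\<close>, so \<open>(x)\<close> is a reduction.

  Once \<open>x \<mm>\<^sup>n = \<mm>\<^sup>n\<^sup>+\<^sup>1\<close>, cancelling \<open>x\<close> shows that \<open>x \<mm>\<^sup>n\<close> is \<open>\<mm>\<close>-full and full, with \<open>x\<close>
  itself as the witness. Conversely, if \<open>x \<mm>\<^sup>n\<close> is weakly \<open>\<mm>\<close>-full, then the equation
  \<open>x \<mm>\<^sup>n\<^sup>+\<^sup>1 = \<mm>\<^sup>n\<^sup>+\<^sup>2\<close> descends to \<open>x \<mm>\<^sup>n = \<mm>\<^sup>n\<^sup>+\<^sup>1\<close>.\<close>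

section \<open>Ideals of commutative rings\<close>

no_notation Sum_Type.Plus (infixr \<open><+>\<close> 65)

context cring
begin

lemmas ideal_zero = additive_subgroup.zero_closed[OF ideal.axioms(1)]
lemmas ideal_add = additive_subgroup.a_closed[OF ideal.axioms(1)]
lemmas ideal_uminus = additive_subgroup.a_inv_closed[OF ideal.axioms(1)]
lemmas ideal_mult_left = ideal.I_l_closed
lemmas ideal_mult_right = ideal.I_r_closed
lemmas ideal_carrier = ideal.Icarr

lemma ideal_subset: "ideal A R \<Longrightarrow> A \<subseteq> carrier R"
  by (simp add: subsetI ideal.Icarr)

lemma ideal_add_cancel:
  assumes "ideal A R" "a \<in> A" "a \<oplus> b \<in> A" "b \<in> carrier R"
  shows "b \<in> A"
proof -
  have "a \<in> carrier R"
    using assms(1,2) by (rule ideal_carrier)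
  then have "b = \<ominus> a \<oplus> (a \<oplus> b)"
    using assms(4) by (simp add: r_neg1)
  then show ?thesis
    using ideal_add[OF assms(1) ideal_uminus[OF assms(1,2)] assms(3)] by simp
qed

lemma ideal_prod_le:
  assumes "ideal K R" "\<And>a b. a \<in> A \<Longrightarrow> b \<in> B \<Longrightarrow> a \<otimes> b \<in> K"
  shows "A \<cdot> B \<subseteq> K"
proof
  fix s
  assume "s \<in> A \<cdot> B"
  then show "s \<in> K"
    by induction (auto intro: assms ideal_add)
qed

lemma ideal_prod_mono:
  assumes "A \<subseteq> A'" "B \<subseteq> B'"
  shows "A \<cdot> B \<subseteq> A' \<cdot> B'"
proof
  fix s
  assume "s \<in> A \<cdot> B"
  then show "s \<in> A' \<cdot> B'"
    by induction (use assms in \<open>auto intro: ideal_prod.intros\<close>)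
qed

text \<open>A multiple r x times j equals x (r j), and sums of elements x j are again of this form.
  Products with a principal ideal can thus be computed elementwise.\<close>

lemma PIdl_prod:
  assumes "x \<in> carrier R" "ideal J R"
  shows "(PIdl x) \<cdot> J = (\<otimes>) x ` J"
proof
  show "(PIdl x) \<cdot> J \<subseteq> (\<otimes>) x ` J"
  proof
    fix s
    assume "s \<in> (PIdl x) \<cdot> J"
    then show "s \<in> (\<otimes>) x ` J"
    proof induction
      case (prod i j)
      then obtain r where r: "r \<in> carrier R" "i = r \<otimes> x"
        unfolding cgenideal_def by blast
      then have "i \<otimes> j = x \<otimes> (r \<otimes> j)"
        using assms(1) ideal_carrier[OF assms(2) prod(2)] by (simp add: m_ac)
      then show ?case
        using ideal_mult_left[OF assms(2) prod(2) r(1)] by blast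
    next
      case (sum s t)
      from sum.IH obtain i where i: "i \<in> J" "s = x \<otimes> i" by blast
      from sum.IH obtain j where j: "j \<in> J" "t = x \<otimes> j" by blast
      have "s \<oplus> t = x \<otimes> (i \<oplus> j)"
        using i j assms(1) ideal_carrier[OF assms(2)] by (simp add: r_distr)
      then show ?case
        using ideal_add[OF assms(2) i(1) j(1)] by blast
    qed
  qed
  show "(\<otimes>) x ` J \<subseteq> (PIdl x) \<cdot> J"
    using cgenideal_self[OF assms(1)] by (auto intro: ideal_prod.prod)
qed

lemma set_add_iff: "s \<in> A <+> B \<longleftrightarrow> (\<exists>a\<in>A. \<exists>b\<in>B. s = a \<oplus> b)"
  unfolding set_add_def' by auto

lemma set_add_upper:
  assumes "ideal A R" "ideal B R"
  shows "A \<subseteq> A <+> B" "B \<subseteq> A <+> B"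
proof -
  show "A \<subseteq> A <+> B"
  proof
    fix a assume a: "a \<in> A"
    then have "a = a \<oplus> \<zero>"
      by (simp add: ideal_carrier[OF assms(1)])
    with a show "a \<in> A <+> B"
      unfolding set_add_iff using ideal_zero[OF assms(2)] by blast
  qed
  show "B \<subseteq> A <+> B"
  proof
    fix b assume b: "b \<in> B"
    then have "b = \<zero> \<oplus> b"
      by (simp add: ideal_carrier[OF assms(2)])
    with b show "b \<in> A <+> B"
      unfolding set_add_iff using ideal_zero[OF assms(1)] by blast
  qed
qed

lemma set_add_least:
  assumes "ideal K R" "A \<subseteq> K" "B \<subseteq> K"
  shows "A <+> B \<subseteq> K"
proof
  fix s
  assume "s \<in> A <+> B"
  then obtain a b where "a \<in> K" "b \<in> K" "s = a \<oplus> b"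
    using assms(2,3) unfolding set_add_iff by blast
  then show "s \<in> K"
    using ideal_add[OF assms(1)] by simp
qed

text \<open>If both pairs agreed, an l in L would be k + b with k in K and b in B; then b lies in L
  \<inter> B = K \<inter> B, so l lies in K. This is what makes glued rank functions strictly
  increasing.\<close>

lemma ideal_modular:
  assumes "ideal K R" "ideal L R" "ideal B R" "K \<subset> L"
  shows "K \<inter> B \<subset> L \<inter> B \<or> K <+> B \<subset> L <+> B"
proof (rule ccontr)
  assume neg: "\<not> ?thesis"
  have "K \<inter> B \<subseteq> L \<inter> B" "K <+> B \<subseteq> L <+> B"
    using assms(4) unfolding subset_iff set_add_iff by blast+
  with neg have eq: "K \<inter> B = L \<inter> B" "K <+> B = L <+> B"
    by auto
  have "L \<subseteq> K"
  proof
    fix l assume l: "l \<in> L"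
    then have "l \<in> K <+> B"
      using eq set_add_upper assms by blast
    then obtain k b where kb: "k \<in> K" "b \<in> B" "l = k \<oplus> b"
      by (auto simp: set_add_iff)
    have "b \<in> L"
      using ideal_add_cancel[OF assms(2), of k b] kb l assms(4) ideal_carrier[OF assms(3)] by blast
    then have "b \<in> K"
      using kb eq by blast
    then show "l \<in> K"
      using kb ideal_add[OF assms(1)] by blast
  qed
  then show False
    using assms(4) by blast
qed

section \<open>Colon ideals and powers of ideals\<close>

lemma colon_ideal:
  assumes "ideal A R" "B \<subseteq> carrier R"
  shows "ideal (colon R A B) R"
proof (rule idealI)
  show "ring R" ..
  show "subgroup (colon R A B) (add_monoid R)"
  proof (rule add.subgroupI)
    show "colon R A B \<subseteq> carrier R"
      by (auto simp: colon_def)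
    have "\<zero> \<in> colon R A B"
      using assms ideal_zero by (auto simp: colon_def subset_iff)
    then show "colon R A B \<noteq> {}" by blast
    show "\<ominus> a \<in> colon R A B" if "a \<in> colon R A B" for a
      using that assms ideal_uminus[OF assms(1)] by (auto simp: colon_def l_minus subset_iff)
    show "a \<oplus> b \<in> colon R A B" if "a \<in> colon R A B" "b \<in> colon R A B" for a b
      using that assms ideal_add[OF assms(1)] by (auto simp: colon_def l_distr subset_iff)
  qed
  show "x \<otimes> a \<in> colon R A B" if "a \<in> colon R A B" "x \<in> carrier R" for a x
    using that assms ideal_mult_left[OF assms(1)] by (auto simp: colon_def m_assoc subset_iff)
  then show "a \<otimes> x \<in> colon R A B" if "a \<in> colon R A B" "x \<in> carrier R" for a x
    using that m_comm by (auto simp: colon_def)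
qed

lemma colon_PIdl:
  assumes "ideal A R" "x \<in> carrier R"
  shows "colon R A (PIdl x) = {r \<in> carrier R. r \<otimes> x \<in> A}"
proof -
  have "r \<otimes> (s \<otimes> x) \<in> A" if "r \<otimes> x \<in> A" "r \<in> carrier R" "s \<in> carrier R" for r s
  proof -
    have "r \<otimes> (s \<otimes> x) = s \<otimes> (r \<otimes> x)"
      using that assms(2) by algebra
    then show ?thesis
      using that ideal_mult_left[OF assms(1)] by simp
  qed
  moreover have "x = \<one> \<otimes> x"
    using assms by simp
  ultimately show ?thesis
    unfolding colon_def cgenideal_def by force
qed

lemma ideals_set_simps [simp]:
  "\<one>\<^bsub>ideals_set R\<^esub> = carrier R" "A \<otimes>\<^bsub>ideals_set R\<^esub> B = A \<cdot> B"
  by (simp_all add: ideals_set_def)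

lemma ideal_pow_ideal: "ideal A R \<Longrightarrow> ideal (ideal_pow R A n) R"
  by (induction n) (auto simp: oneideal ideal_prod_is_ideal)

lemma ideal_pow_Suc: "ideal A R \<Longrightarrow> ideal_pow R A (Suc n) = A \<cdot> ideal_pow R A n"
  by (simp add: ideal_prod_commute ideal_pow_ideal)

lemma ideal_pow_add:
  assumes "ideal A R"
  shows "ideal_pow R A (m + n) = ideal_pow R A m \<cdot> ideal_pow R A n"
  by (induction n)
    (simp_all add: assms ideal_prod_one ideal_pow_ideal ideal_prod_assoc)

lemma pow_in_ideal_pow:
  assumes "a \<in> A"
  shows "a [^] n \<in> ideal_pow R A n"
  by (induction n) (auto intro: ideal_prod.prod assms)

end

section \<open>Lengths of intervals of ideals\<close>

text \<open>For ideals \<open>A \<subseteq> B\<close> this says that the module \<open>B/A\<close> has length at most \<open>N\<close>. A strictly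
  increasing rank function replaces chains: it restricts to both halves of an interval, and two
  rank functions can be glued by the modular law.\<close>

definition length_le :: "('a, 'b) ring_scheme \<Rightarrow> 'a set \<Rightarrow> 'a set \<Rightarrow> nat \<Rightarrow> bool"
  where "length_le R A B N \<longleftrightarrow> (\<exists>f :: 'a set \<Rightarrow> nat.
    (\<forall>K L. ideal K R \<longrightarrow> ideal L R \<longrightarrow> A \<subseteq> K \<longrightarrow> K \<subset> L \<longrightarrow> L \<subseteq> B \<longrightarrow> f K < f L) \<and> f B \<le> N)"

lemma length_leI:
  assumes "\<And>K L. ideal K R \<Longrightarrow> ideal L R \<Longrightarrow> A \<subseteq> K \<Longrightarrow> K \<subset> L \<Longrightarrow> L \<subseteq> B \<Longrightarrow> f K < f L"
    and "f B \<le> N"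
  shows "length_le R A B N"
  using assms unfolding length_le_def by blast

lemma length_leE:
  assumes "length_le R A B N"
  obtains f :: "'a set \<Rightarrow> nat" where "f B \<le> N"
    "\<And>K L. ideal K R \<Longrightarrow> ideal L R \<Longrightarrow> A \<subseteq> K \<Longrightarrow> K \<subset> L \<Longrightarrow> L \<subseteq> B \<Longrightarrow> f K < f L"
  using assms unfolding length_le_def by blast

context cring
begin

lemma length_le_lower:
  assumes "length_le R A B N" "A \<subseteq> A'"
  shows "length_le R A' B N"
  using assms unfolding length_le_def by (meson subset_trans)

lemma length_le_trans:
  assumes "length_le R A B M" "length_le R B C N"
    and ideals: "ideal A R" "ideal B R" "ideal C R" and sub: "A \<subseteq> B" "B \<subseteq> C"
  shows "length_le R A C (M + N)"
proof -
  from assms(1) obtain f where f: "f B \<le> M"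
    "\<And>K L. ideal K R \<Longrightarrow> ideal L R \<Longrightarrow> A \<subseteq> K \<Longrightarrow> K \<subset> L \<Longrightarrow> L \<subseteq> B \<Longrightarrow> (f K :: nat) < f L"
    by (rule length_leE) blast
  from assms(2) obtain g where g: "g C \<le> N"
    "\<And>K L. ideal K R \<Longrightarrow> ideal L R \<Longrightarrow> B \<subseteq> K \<Longrightarrow> K \<subset> L \<Longrightarrow> L \<subseteq> C \<Longrightarrow> (g K :: nat) < g L"
    by (rule length_leE) blast
  show ?thesis
  \<comment> \<open>K is measured by its trace on B, an ideal between A and B, plus its sum with B,
    an ideal between B and C. For K = C these are B and C themselves, which gives the bound.\<close>
  proof (rule length_leI[where f = "\<lambda>K. f (K \<inter> B) + g (K <+> B)"])
    fix K L
    assume K: "ideal K R" and L: "ideal L R" and KL: "A \<subseteq> K" "K \<subset> L" "L \<subseteq> C"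
    have "K \<inter> B = L \<inter> B \<or> f (K \<inter> B) < f (L \<inter> B)"
      using f(2)[OF i_intersect[OF K ideals(2)] i_intersect[OF L ideals(2)]] KL sub by blast
    moreover have "K <+> B \<subseteq> L <+> B"
      using KL(2) unfolding subset_iff set_add_iff by blast
    then have "K <+> B = L <+> B \<or> g (K <+> B) < g (L <+> B)"
      using g(2)[of "K <+> B" "L <+> B"] add_ideals[OF K ideals(2)] add_ideals[OF L ideals(2)]
        set_add_upper(2)[OF K ideals(2)] set_add_least[OF ideals(3) KL(3) sub(2)] by blast
    ultimately show "f (K \<inter> B) + g (K <+> B) < f (L \<inter> B) + g (L <+> B)"
      using ideal_modular[OF K L ideals(2) KL(2)] by auto
  next
    have "C \<inter> B = B" "C <+> B = C"
      using sub set_add_upper(1)[OF ideals(3,2)] set_add_least[OF ideals(3), of C B] by blast+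
    then show "f (C \<inter> B) + g (C <+> B) \<le> M + N"
      using f(1) g(1) by simp
  qed
qed

text \<open>The map \<open>K \<mapsto> (K : a)\<close> embeds the ideals between \<open>J\<close> and \<open>J + (a)\<close> into those
  above \<open>(J : a)\<close>.\<close>

lemma length_le_colon:
  assumes "ideal J R" "a \<in> carrier R" "length_le R {r \<in> carrier R. r \<otimes> a \<in> J} (carrier R) N"
  shows "length_le R J (J <+> PIdl a) N"
proof -
  define \<phi> where "\<phi> K = {r \<in> carrier R. r \<otimes> a \<in> K}" for K
  have \<phi>: "ideal (\<phi> K) R" if "ideal K R" for K
    using colon_ideal[OF that ideal_subset[OF cgenideal_ideal[OF assms(2)]]]
    by (simp add: \<phi>_def colon_PIdl[OF that assms(2)])
  from assms(3) obtain f where f: "f (carrier R) \<le> N"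
    "\<And>K L. ideal K R \<Longrightarrow> ideal L R \<Longrightarrow> \<phi> J \<subseteq> K \<Longrightarrow> K \<subset> L \<Longrightarrow> L \<subseteq> carrier R \<Longrightarrow> (f K :: nat) < f L"
    unfolding \<phi>_def by (rule length_leE) blast
  show ?thesis
  proof (rule length_leI[where f = "\<lambda>K. f (\<phi> K)"])
    fix K L
    assume K: "ideal K R" and L: "ideal L R" and KL: "J \<subseteq> K" "K \<subset> L" "L \<subseteq> J <+> PIdl a"
    \<comment> \<open>An element of L has the form j + r a with j in J. Hence r a lies in L, and r
      in \<open>\<phi> L\<close> decides whether r a lies in K.\<close>
    have "\<phi> K \<noteq> \<phi> L"
    proof
      assume eq: "\<phi> K = \<phi> L"
      have "l \<in> K" if l: "l \<in> L" for l
      proof -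
        have "l \<in> J <+> PIdl a"
          using KL(3) l ..
        then obtain j r where jr: "j \<in> J" "r \<in> carrier R" "l = j \<oplus> r \<otimes> a"
          unfolding set_add_iff cgenideal_def by blast
        have "r \<otimes> a \<in> L"
          using ideal_add_cancel[OF L, of j "r \<otimes> a"] jr l KL assms(2) by blast
        then have "r \<in> \<phi> K"
          unfolding eq using jr(2) by (simp add: \<phi>_def)
        then show ?thesis
          using ideal_add[OF K] jr KL by (auto simp: \<phi>_def)
      qed
      with KL show False by blast
    qed
    with KL have "\<phi> J \<subseteq> \<phi> K" "\<phi> K \<subset> \<phi> L" "\<phi> L \<subseteq> carrier R"
      by (auto simp: \<phi>_def)
    then show "f (\<phi> K) < f (\<phi> L)"
      using f(2) \<phi> K L by blast
  next
    have "\<phi> (J <+> PIdl a) \<subseteq> carrier R" "\<phi> J \<subseteq> \<phi> (J <+> PIdl a)"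
      using set_add_upper(1)[OF assms(1) cgenideal_ideal[OF assms(2)]] by (auto simp: \<phi>_def)
    then have "f (\<phi> (J <+> PIdl a)) \<le> f (carrier R)"
      using f(2)[OF \<phi> oneideal, of "J <+> PIdl a"] add_ideals[OF assms(1) cgenideal_ideal[OF assms(2)]]
      by (metis order_le_less psubsetI subset_refl)
    then show "f (\<phi> (J <+> PIdl a)) \<le> N"
      using f(1) by linarith
  qed
qed

section \<open>Non-zero-divisors and lengths of quotients\<close>

lemma nzd_cancel:
  assumes "nonzerodivisor R w" "a \<in> carrier R" "b \<in> carrier R" "w \<otimes> a = w \<otimes> b"
  shows "a = b"
proof -
  have w: "w \<in> carrier R"
    using assms(1) by (simp add: nonzerodivisor_def)
  have "w \<otimes> (a \<ominus> b) = w \<otimes> a \<ominus> w \<otimes> b"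
    using w assms(2,3) by algebra
  also have "\<dots> = \<zero>"
    using w assms by (simp add: r_right_minus_eq)
  finally have "a \<ominus> b = \<zero>"
    using assms by (simp add: nonzerodivisor_def)
  then show ?thesis
    using assms by simp
qed

lemma nzd_mult:
  assumes "nonzerodivisor R a" "nonzerodivisor R b"
  shows "nonzerodivisor R (a \<otimes> b)"
  unfolding nonzerodivisor_def
proof (intro conjI ballI impI)
  have ab: "a \<in> carrier R" "b \<in> carrier R"
    using assms unfolding nonzerodivisor_def by blast+
  then show "a \<otimes> b \<in> carrier R" by simp
  fix y
  assume y: "y \<in> carrier R" "a \<otimes> b \<otimes> y = \<zero>"
  then have "a \<otimes> (b \<otimes> y) = \<zero>"
    using ab by (simp add: m_assoc)
  moreover have "b \<otimes> y \<in> carrier R"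
    using y(1) ab by simp
  ultimately have "b \<otimes> y = \<zero>"
    using assms(1) unfolding nonzerodivisor_def by blast
  then show "y = \<zero>"
    using assms(2) y(1) unfolding nonzerodivisor_def by blast
qed

lemma nzd_pow:
  assumes "nonzerodivisor R a"
  shows "nonzerodivisor R (a [^] (n::nat))"
proof (induction n)
  case 0
  show ?case
    unfolding nonzerodivisor_def by simp
next
  case (Suc n)
  then show ?case
    using nzd_mult[OF _ assms] by simp
qed

lemma colon_nzd_prod:
  assumes "nonzerodivisor R w" "ideal J R"
  shows "{r \<in> carrier R. r \<otimes> w \<in> (PIdl w) \<cdot> J} = J"
proof -
  have w: "w \<in> carrier R"
    using assms(1) by (simp add: nonzerodivisor_def)
  have "r \<in> J" if r: "r \<in> carrier R" "r \<otimes> w = w \<otimes> j" "j \<in> J" for r j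
    using nzd_cancel[OF assms(1) r(1), of j] r w ideal_carrier[OF assms(2)] by (simp add: m_comm)
  moreover have "r \<in> carrier R \<and> r \<otimes> w = w \<otimes> r" if "r \<in> J" for r
    using that w ideal_carrier[OF assms(2)] by (simp add: m_comm)
  ultimately show ?thesis
    unfolding PIdl_prod[OF w assms(2)] by blast
qed

text \<open>Multiplication by w maps R/J isomorphically onto wR/wJ. Here this is the case a = w of
  \<open>length_le_colon\<close> with base wJ, because (wJ : w) = J.\<close>

lemma length_le_nzd_prod:
  assumes w: "nonzerodivisor R w" and J: "ideal J R" and len: "length_le R J (carrier R) N"
  shows "length_le R ((PIdl w) \<cdot> J) (PIdl w) N"
proof -
  have wR: "w \<in> carrier R"
    using w by (simp add: nonzerodivisor_def)
  let ?A = "(PIdl w) \<cdot> J"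
  have ideals: "ideal (PIdl w) R" "ideal ?A R"
    using cgenideal_ideal[OF wR] J ideal_prod_is_ideal by auto
  have "?A \<subseteq> PIdl w"
    using ideal_prod_inter[OF ideals(1) J] by blast
  then have "?A <+> PIdl w = PIdl w"
    using set_add_least[OF ideals(1), of ?A "PIdl w"] set_add_upper(2)[OF ideals(2,1)] by blast
  then show ?thesis
    using length_le_colon[OF ideals(2) wR, of N] len colon_nzd_prod[OF w J] by simp
qed

lemma PIdl_pow_Suc:
  assumes "w \<in> carrier R"
  shows "PIdl (w [^] Suc c) = (PIdl w) \<cdot> (PIdl (w [^] (c::nat)))"
proof -
  have eq: "r \<otimes> (w [^] Suc c) = w \<otimes> (r \<otimes> w [^] c)" if "r \<in> carrier R" for r
    using m_comm[OF nat_pow_closed[OF assms, of c] assms] m_lcomm[OF that assms] assms by simp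
  have "PIdl (w [^] Suc c) = {w \<otimes> (r \<otimes> w [^] c) | r. r \<in> carrier R}"
    unfolding cgenideal_def by (rule Collect_cong) (metis eq)
  also have "\<dots> = (\<otimes>) w ` (PIdl (w [^] c))"
    unfolding cgenideal_def by blast
  finally show ?thesis
    unfolding PIdl_prod[OF assms cgenideal_ideal[OF nat_pow_closed[OF assms]]] .
qed

text \<open>The chain of the ideals generated by the powers of w up to w^c has c factors, each
  isomorphic to R/wR. The induction splits at wR and identifies the lower half with R modulo the
  preceding power.\<close>

lemma length_le_nzd_pow:
  assumes w: "nonzerodivisor R w" and len: "length_le R (PIdl w) (carrier R) e"
  shows "length_le R (PIdl (w [^] (c::nat))) (carrier R) (c * e)"
proof (induction c)
  case 0
  have "PIdl \<one> = carrier R"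
    using cgenideal_eq_genideal genideal_one by simp
  then show ?case
    by (intro length_leI[of _ _ _ "\<lambda>_. 0"]) auto
next
  case (Suc c)
  have wR: "w \<in> carrier R"
    using w by (simp add: nonzerodivisor_def)
  have ideals: "ideal (PIdl w) R" "ideal (PIdl (w [^] c)) R"
    using wR cgenideal_ideal by auto
  have "length_le R (PIdl (w [^] Suc c)) (carrier R) (c * e + e)"
    unfolding PIdl_pow_Suc[OF wR]
    using length_le_nzd_prod[OF w ideals(2) Suc] len
  proof (rule length_le_trans)
    show "(PIdl w) \<cdot> (PIdl (w [^] c)) \<subseteq> PIdl w"
      using ideal_prod_inter[OF ideals] by blast
  qed (use ideals oneideal ideal_prod_is_ideal ideal_subset in auto)
  then show ?case
    by (simp add: add.commute)
qed

text \<open>The lengths of \<open>J/wJ\<close> and \<open>R/wR\<close> are both obtained from that of \<open>R/wJ\<close> by removing the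
  length of \<open>R/J\<close>, which equals that of \<open>wR/wJ\<close>. The power of \<open>w\<close> in \<open>J\<close> makes it finite.\<close>

lemma length_le_mult_nzd:
  assumes w: "nonzerodivisor R w" and len: "length_le R (PIdl w) (carrier R) e"
    and J: "ideal J R" and c: "w [^] (c::nat) \<in> J"
  shows "length_le R ((PIdl w) \<cdot> J) J e"
proof -
  have wR: "w \<in> carrier R"
    using w by (simp add: nonzerodivisor_def)
  let ?A = "(PIdl w) \<cdot> J"
  have ideals: "ideal (PIdl w) R" "ideal ?A R"
    using cgenideal_ideal[OF wR] J ideal_prod_is_ideal by auto
  have sub: "?A \<subseteq> PIdl w" "?A \<subseteq> J" "PIdl w \<subseteq> carrier R" "J \<subseteq> carrier R"
    using ideal_prod_inter[OF ideals(1) J] ideal_subset J ideals by auto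
  \<comment> \<open>The least bound is the exact length of R/J, and only an exact length can be
    subtracted.\<close>
  define M where "M = (LEAST N. length_le R J (carrier R) N)"
  have "length_le R J (carrier R) (c * e)"
    using length_le_nzd_pow[OF w len] cgenideal_minimal[OF J c] by (rule length_le_lower)
  then have M: "length_le R J (carrier R) M"
    unfolding M_def by (rule LeastI)
  have "length_le R ?A (carrier R) (M + e)"
    by (rule length_le_trans[OF length_le_nzd_prod[OF w J M] len ideals(2,1) oneideal sub(1,3)])
  then obtain f where f: "f (carrier R) \<le> M + e"
    "\<And>K L. ideal K R \<Longrightarrow> ideal L R \<Longrightarrow> ?A \<subseteq> K \<Longrightarrow> K \<subset> L \<Longrightarrow> L \<subseteq> carrier R \<Longrightarrow> (f K :: nat) < f L"
    by (rule length_leE) blast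
  have fJ: "f J \<le> f K" if K: "ideal K R" "J \<subseteq> K" for K
  proof (cases "J = K")
    case False
    then show ?thesis
      using f(2)[OF J K(1) sub(2)] K(2) ideal_subset[OF K(1)] by (simp add: psubsetI less_imp_le)
  qed simp
  \<comment> \<open>Shifting f by its value at J gives a rank function above J, so minimality of M
    yields M \<le> f(R) - f(J). Together with f(R) \<le> M + e this leaves f(J) \<le> e.\<close>
  have "length_le R J (carrier R) (f (carrier R) - f J)"
  proof (rule length_leI[where f = "\<lambda>K. f K - f J"])
    fix K L
    assume K: "ideal K R" and L: "ideal L R" and KL: "J \<subseteq> K" "K \<subset> L" "L \<subseteq> carrier R"
    show "f K - f J < f L - f J"
      using f(2)[OF K L] fJ[OF K KL(1)] KL sub by (meson diff_less_mono subset_trans)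
  qed simp
  then have "M \<le> f (carrier R) - f J"
    unfolding M_def by (rule Least_le)
  then have "f J \<le> e"
    using fJ[OF oneideal sub(4)] f(1) by linarith
  show ?thesis
  proof (rule length_leI[where f = f])
    fix K L
    assume "ideal K R" "ideal L R" "?A \<subseteq> K" "K \<subset> L" "L \<subseteq> J"
    then show "f K < f L"
      using f(2) sub by blast
  qed fact
qed

end

section \<open>Local rings of dimension one\<close>

text \<open>In a Noetherian ring a nonempty chain of ideals contains its own union, so Zorn's lemma
  applies within any nonempty set of ideals.\<close>

lemma (in noetherian_ring) ideal_maximal_ex:
  assumes "S \<noteq> {}" and "\<And>A. A \<in> S \<Longrightarrow> ideal A R"
  shows "\<exists>M\<in>S. \<forall>A\<in>S. M \<subseteq> A \<longrightarrow> A = M"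
proof (rule subset_Zorn_nonempty[OF assms(1)])
  fix \<C>
  assume C: "\<C> \<noteq> {}" "subset.chain S \<C>"
  then have "subset.chain {I. ideal I R} \<C>"
    using assms(2) by (auto simp: subset.chain_def)
  then have "\<Union>\<C> \<in> \<C>"
    by (rule ideal_chain_is_trivial[OF C(1)])
  then show "\<Union>\<C> \<in> S"
    using C(2) by (auto simp: subset.chain_def)
qed

lemma (in cring) ideal_insert:
  assumes "ideal A R" "a \<in> carrier R" "a \<notin> A"
  shows "ideal (A <+> PIdl a) R" "A \<subset> A <+> PIdl a"
proof -
  have P: "ideal (PIdl a) R"
    by (rule cgenideal_ideal[OF assms(2)])
  show "ideal (A <+> PIdl a) R"
    by (rule add_ideals[OF assms(1) P])
  show "A \<subset> A <+> PIdl a"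
    using set_add_upper[OF assms(1) P] cgenideal_self[OF assms(2)] assms(3) by blast
qed

context noetherian_local_ring
begin

lemma max_ideal: "ideal \<mm> R"
  using maximal by (rule maximalideal.axioms(1))

lemma one_notin_max: "\<one> \<notin> \<mm>"
  using ideal.one_imp_carrier[OF max_ideal] maximalideal.I_notcarr[OF maximal] by metis

text \<open>If r had no inverse, an ideal maximal among those containing r but not 1 would be a
  maximal ideal, hence equal to \<mm>, although r is not in \<mm>.\<close>

lemma not_max_inverse:
  assumes r: "r \<in> carrier R" "r \<notin> \<mm>"
  shows "\<exists>s\<in>carrier R. s \<otimes> r = \<one>"
proof (rule ccontr)
  assume neg: "\<not> ?thesis"
  define S where "S = {A. ideal A R \<and> r \<in> A \<and> \<one> \<notin> A}"
  have "\<one> \<notin> PIdl r"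
    using neg unfolding cgenideal_def by force
  then have "PIdl r \<in> S"
    unfolding S_def using cgenideal_ideal[OF r(1)] cgenideal_self[OF r(1)] by blast
  then obtain M where M: "M \<in> S" "\<forall>A\<in>S. M \<subseteq> A \<longrightarrow> A = M"
    using ideal_maximal_ex[of S] unfolding S_def by blast
  have "maximalideal M R"
  proof (rule maximalidealI)
    show "ideal M R" "carrier R \<noteq> M"
      using M(1) one_closed unfolding S_def by blast+
    fix J
    assume J: "ideal J R" "M \<subseteq> J"
    show "J = M \<or> J = carrier R"
    proof (cases "\<one> \<in> J")
      case True
      then show ?thesis
        using ideal.one_imp_carrier[OF J(1)] by simp
    next
      case False
      then have "J \<in> S"
        using J M(1) unfolding S_def by blast
      then show ?thesis
        using M(2) J(2) by blast
    qed
  qed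
  then have "M = \<mm>"
    by (rule maximal_unique)
  then show False
    using M(1) r(2) unfolding S_def by blast
qed

text \<open>Suppose L is maximal among the ideals that contain K but not J, and g lies in J but not
  in L. Maximality gives J \<subseteq> L + (g), so the hypothesis yields g = l + g a with l in L and
  a in \<mm>. Since 1 - a is a unit, g lies in L after all.\<close>

lemma nakayama:
  assumes J: "ideal J R" and K: "ideal K R" and le: "J \<subseteq> K <+> \<mm> \<cdot> J"
  shows "J \<subseteq> K"
proof (rule ccontr)
  assume neg: "\<not> J \<subseteq> K"
  define S where "S = {L. ideal L R \<and> K \<subseteq> L \<and> \<not> J \<subseteq> L}"
  have "K \<in> S"
    using neg K unfolding S_def by blast
  then obtain L where L: "L \<in> S" "\<forall>A\<in>S. L \<subseteq> A \<longrightarrow> A = L"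
    using ideal_maximal_ex[of S] unfolding S_def by blast
  then have L': "ideal L R" "K \<subseteq> L"
    unfolding S_def by blast+
  obtain g where g: "g \<in> J" "g \<notin> L"
    using L(1) unfolding S_def by blast
  have gR: "g \<in> carrier R"
    using J g(1) by (rule ideal_carrier)
  note Lg = ideal_insert[OF L'(1) gR g(2)]
  have "J \<subseteq> L <+> PIdl g"
  proof (rule ccontr)
    assume "\<not> J \<subseteq> L <+> PIdl g"
    then have "L <+> PIdl g \<in> S"
      using Lg L'(2) unfolding S_def by blast
    then show False
      using L(2) Lg(2) by blast
  qed
  define T where "T = L <+> (PIdl g) \<cdot> \<mm>"
  have gm: "ideal ((PIdl g) \<cdot> \<mm>) R"
    by (rule ideal_prod_is_ideal[OF cgenideal_ideal[OF gR] max_ideal])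
  have T: "ideal T R" "L \<subseteq> T" "(PIdl g) \<cdot> \<mm> \<subseteq> T"
    unfolding T_def using add_ideals[OF L'(1) gm] set_add_upper[OF L'(1) gm] by blast+
  have "\<mm> \<cdot> J \<subseteq> T"
  proof (rule ideal_prod_le[OF T(1)])
    fix a b
    assume a: "a \<in> \<mm>" and "b \<in> J"
    then obtain l r where lr: "l \<in> L" "r \<in> carrier R" "b = l \<oplus> r \<otimes> g"
      using \<open>J \<subseteq> L <+> PIdl g\<close> unfolding set_add_def' cgenideal_def by blast
    have aR: "a \<in> carrier R"
      using max_ideal a by (rule ideal_carrier)
    have lR: "l \<in> carrier R"
      using L'(1) lr(1) by (rule ideal_carrier)
    have "a \<otimes> b = a \<otimes> l \<oplus> (r \<otimes> g) \<otimes> a"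
      using aR lR lr gR by (simp add: r_distr m_ac)
    moreover have "a \<otimes> l \<in> T"
      using ideal_mult_left[OF L'(1) lr(1) aR] T(2) by blast
    moreover have "r \<otimes> g \<in> PIdl g"
      using lr(2) unfolding cgenideal_def by blast
    then have "(r \<otimes> g) \<otimes> a \<in> T"
      using ideal_prod.prod[OF _ a, of "r \<otimes> g" "PIdl g" R] T(3) by blast
    ultimately show "a \<otimes> b \<in> T"
      using ideal_add[OF T(1)] by simp
  qed
  then have "J \<subseteq> T"
    using le set_add_least[OF T(1), of K "\<mm> \<cdot> J"] L'(2) T(2) by blast
  then have "g \<in> T"
    using g(1) by blast
  then obtain l a where la: "l \<in> L" "a \<in> \<mm>" "g = l \<oplus> g \<otimes> a"
    unfolding T_def PIdl_prod[OF gR max_ideal] set_add_def' by blast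
  have aR: "a \<in> carrier R"
    using max_ideal la(2) by (rule ideal_carrier)
  have lR: "l \<in> carrier R"
    using L'(1) la(1) by (rule ideal_carrier)
  have "(\<one> \<ominus> a) \<otimes> g = g \<ominus> g \<otimes> a"
    using aR gR by algebra
  also have "\<dots> = (l \<oplus> g \<otimes> a) \<ominus> g \<otimes> a"
    using la(3) by simp
  also have "\<dots> = l"
    using aR gR lR by algebra
  finally have l: "(\<one> \<ominus> a) \<otimes> g = l" .
  have "\<one> \<ominus> a \<notin> \<mm>"
  proof
    assume "\<one> \<ominus> a \<in> \<mm>"
    then have "a \<oplus> (\<one> \<ominus> a) \<in> \<mm>"
      using ideal_add[OF max_ideal la(2)] by blast
    moreover have "a \<oplus> (\<one> \<ominus> a) = \<one>"
      using aR by algebra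
    ultimately show False
      using one_notin_max by simp
  qed
  then obtain s where s: "s \<in> carrier R" "s \<otimes> (\<one> \<ominus> a) = \<one>"
    using not_max_inverse[of "\<one> \<ominus> a"] aR by auto
  have "g = s \<otimes> (\<one> \<ominus> a) \<otimes> g"
    using s(2) gR by simp
  also have "\<dots> = s \<otimes> ((\<one> \<ominus> a) \<otimes> g)"
    using s(1) aR gR by (simp add: m_assoc)
  also have "\<dots> = s \<otimes> l"
    by (simp only: l)
  also have "\<dots> \<in> L"
    using ideal_mult_left[OF L'(1) la(1) s(1)] .
  finally show False
    using g(2) by simp
qed

section \<open>Primes containing a non-zero-divisor and finite length of the quotient\<close>

text \<open>The smaller prime is an ideal maximal among those missing all \<open>s w\<^sup>k\<close> with \<open>s \<notin> P\<close>.\<close>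

lemma prime_below_nzd:
  assumes P: "primeideal P R" and w: "nonzerodivisor R w" "w \<in> P"
  shows "\<exists>Q. primeideal Q R \<and> Q \<subset> P"
proof -
  have wR: "w \<in> carrier R"
    using w(1) unfolding nonzerodivisor_def by blast
  have Pid: "ideal P R"
    using P by (rule primeideal.axioms(1))
  have oneP: "\<one> \<notin> P"
    using ideal.one_imp_carrier[OF Pid] primeideal.I_notcarr[OF P] by metis
  define S where "S = {A. ideal A R \<and> (\<forall>s\<in>carrier R - P. \<forall>k::nat. s \<otimes> w [^] k \<notin> A)}"
  have "s \<otimes> w [^] k \<noteq> \<zero>" if s: "s \<in> carrier R - P" for s and k :: nat
  proof
    assume "s \<otimes> w [^] k = \<zero>"
    then have "w [^] k \<otimes> s = \<zero>"
      using s wR by (simp add: m_comm)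
    then have "s = \<zero>"
      using nzd_pow[OF w(1), of k] s unfolding nonzerodivisor_def by blast
    then show False
      using s ideal_zero[OF Pid] by blast
  qed
  then have "{\<zero>} \<in> S"
    unfolding S_def using zeroideal by blast
  then obtain Q where Q: "Q \<in> S" "\<forall>A\<in>S. Q \<subseteq> A \<longrightarrow> A = Q"
    using ideal_maximal_ex[of S] unfolding S_def by blast
  have Qid: "ideal Q R"
    using Q(1) unfolding S_def by blast
  have Qmiss: "s \<otimes> w [^] k \<notin> Q" if "s \<in> carrier R" "s \<notin> P" for s and k :: nat
    using Q(1) that unfolding S_def by blast
  \<comment> \<open>By maximality of Q, adjoining any a outside Q produces an ideal that meets the
    multiplicative set of all s w^k with s outside P.\<close>
  have hit: "\<exists>q s k r. q \<in> Q \<and> s \<in> carrier R \<and> s \<notin> P \<and> r \<in> carrier R \<and> s \<otimes> w [^] (k::nat) = q \<oplus> r \<otimes> a"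
    if a: "a \<in> carrier R" "a \<notin> Q" for a
  proof -
    note Qa = ideal_insert[OF Qid a]
    have "Q <+> PIdl a \<notin> S"
      using Q(2) Qa(2) by blast
    then obtain s k where "s \<in> carrier R" "s \<notin> P" "s \<otimes> w [^] (k::nat) \<in> Q <+> PIdl a"
      using Qa(1) unfolding S_def by blast
    then show ?thesis
      unfolding set_add_def' cgenideal_def by blast
  qed
  have "primeideal Q R"
  proof (rule primeidealI[OF Qid is_cring])
    have "\<one> \<otimes> w [^] (0::nat) \<notin> Q"
      by (rule Qmiss[OF one_closed oneP])
    then show "carrier R \<noteq> Q"
      by auto
    fix a b
    assume ab: "a \<in> carrier R" "b \<in> carrier R" "a \<otimes> b \<in> Q"
    show "a \<in> Q \<or> b \<in> Q"
    proof (rule ccontr)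
      assume "\<not> (a \<in> Q \<or> b \<in> Q)"
      then obtain q s k r q' s' k' r' where
        1: "q \<in> Q" "s \<in> carrier R" "s \<notin> P" "r \<in> carrier R" "s \<otimes> w [^] (k::nat) = q \<oplus> r \<otimes> a" and
        2: "q' \<in> Q" "s' \<in> carrier R" "s' \<notin> P" "r' \<in> carrier R" "s' \<otimes> w [^] (k'::nat) = q' \<oplus> r' \<otimes> b"
        using hit[OF ab(1)] hit[OF ab(2)] by blast
      have q: "q \<in> carrier R" "q' \<in> carrier R"
        using ideal_carrier[OF Qid 1(1)] ideal_carrier[OF Qid 2(1)] .
      have "(s \<otimes> s') \<otimes> w [^] (k + k') = (s \<otimes> w [^] k) \<otimes> (s' \<otimes> w [^] k')"
        using 1(2) 2(2) wR by (simp add: nat_pow_mult[symmetric] m_ac)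
      also have "\<dots> = (q \<oplus> r \<otimes> a) \<otimes> (q' \<oplus> r' \<otimes> b)"
        by (simp only: 1(5) 2(5))
      \<comment> \<open>Every summand now carries a factor q, q' or a b, all of which lie in
        Q.\<close>
      also have "\<dots> = (q' \<oplus> r' \<otimes> b) \<otimes> q \<oplus> ((r \<otimes> a) \<otimes> q' \<oplus> (r \<otimes> r') \<otimes> (a \<otimes> b))"
        using q 1(4) 2(4) ab(1,2) by algebra
      also have "\<dots> \<in> Q"
        by (intro ideal_add[OF Qid] ideal_mult_left[OF Qid] 1(1) 2(1) ab m_closed a_closed 1(4) 2(4) q)
      finally have "(s \<otimes> s') \<otimes> w [^] (k + k') \<in> Q" .
      moreover have "s \<otimes> s' \<notin> P"
        using primeideal.I_prime[OF P 1(2) 2(2)] 1(3) 2(3) by blast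
      ultimately show False
        using Qmiss 1(2) 2(2) by blast
    qed
  qed
  \<comment> \<open>The exponent 0 keeps Q inside P; below, s = 1 and the exponent 1 keep w out of
    Q.\<close>
  moreover have "Q \<subseteq> P"
  proof
    fix x
    assume x: "x \<in> Q"
    have "x \<in> carrier R"
      using Qid x by (rule ideal_carrier)
    then show "x \<in> P"
      using Qmiss[of x 0] x by auto
  qed
  moreover have "w \<notin> Q"
    using Qmiss[OF one_closed oneP, of 1] wR by simp
  ultimately show ?thesis
    using w(2) by blast
qed

text \<open>Elements outside \<mm> are units, so P lies in \<mm>. If the inclusion were strict, a
  smaller prime Q would give the chain Q, P, \<mm> of length two.\<close>

lemma prime_nzd_maximal:
  assumes dim: "krull_dim R \<le> 1" and P: "primeideal P R" and w: "nonzerodivisor R w" "w \<in> P"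
  shows "P = \<mm>"
proof (rule ccontr)
  assume neq: "P \<noteq> \<mm>"
  obtain Q where Q: "primeideal Q R" "Q \<subset> P"
    using prime_below_nzd[OF P w] by blast
  have Pid: "ideal P R"
    using P by (rule primeideal.axioms(1))
  have "P \<subseteq> \<mm>"
  proof (rule ccontr)
    assume "\<not> P \<subseteq> \<mm>"
    then obtain r where r: "r \<in> P" "r \<notin> \<mm>" by blast
    then obtain s where "s \<in> carrier R" "s \<otimes> r = \<one>"
      using not_max_inverse ideal_carrier[OF Pid] by blast
    then have "\<one> \<in> P"
      using ideal_mult_left[OF Pid r(1)] by metis
    then show False
      using ideal.one_imp_carrier[OF Pid] primeideal.I_notcarr[OF P] by metis
  qed
  define C where "C i = (if i = 0 then Q else if i = 1 then P else \<mm>)" for i :: nat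
  have "\<forall>i\<le>2. primeideal (C i) R"
    using Q(1) P maximalideal_prime[OF maximal] by (simp add: C_def)
  moreover have "\<forall>i<2. C i \<subset> C (Suc i)"
    using Q(2) \<open>P \<subseteq> \<mm>\<close> neq by (auto simp: C_def less_2_cases_iff)
  ultimately have "enat 2 \<le> krull_dim R"
    unfolding krull_dim_def by (intro Sup_upper) blast
  also have "\<dots> \<le> enat 1"
    using dim by (simp add: one_enat_def)
  finally show False
    by simp
qed

text \<open>Noetherian induction: take J maximal among the ideals containing w whose quotient has
  infinite length. If a b is in J but neither factor is, then R/(J + (a)) and (J + (a))/J, which is
  R/(J : a), have finite length, and so has R/J. Hence J is prime, so J = \<mm>, but R/\<mm> has
  length one.\<close>

lemma length_le_quotient_nzd:
  assumes dim: "krull_dim R \<le> 1" and w: "nonzerodivisor R w"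
  shows "\<exists>e. length_le R (PIdl w) (carrier R) e"
proof (rule ccontr)
  assume neg: "\<not> ?thesis"
  have wR: "w \<in> carrier R"
    using w(1) unfolding nonzerodivisor_def by blast
  define S where "S = {A. ideal A R \<and> w \<in> A \<and> \<not> (\<exists>e. length_le R A (carrier R) e)}"
  have "PIdl w \<in> S"
    unfolding S_def using cgenideal_ideal[OF wR] cgenideal_self[OF wR] neg by blast
  then obtain J where J: "J \<in> S" "\<forall>A\<in>S. J \<subseteq> A \<longrightarrow> A = J"
    using ideal_maximal_ex[of S] unfolding S_def by blast
  have J': "ideal J R" "w \<in> J" "\<nexists>e. length_le R J (carrier R) e"
    using J(1) unfolding S_def by blast+
  have good: "\<exists>e. length_le R A (carrier R) e" if "ideal A R" "J \<subset> A" for A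
    using J(2) that J'(2) unfolding S_def by blast
  have "primeideal J R"
  proof (rule primeidealI[OF J'(1) is_cring])
    have "length_le R (carrier R) (carrier R) 0"
      by (rule length_leI[of _ _ _ "\<lambda>_. 0"]) auto
    then show "carrier R \<noteq> J"
      using J'(3) by metis
    fix a b
    assume ab: "a \<in> carrier R" "b \<in> carrier R" "a \<otimes> b \<in> J"
    show "a \<in> J \<or> b \<in> J"
    proof (rule ccontr)
      assume "\<not> (a \<in> J \<or> b \<in> J)"
      then have nab: "a \<notin> J" "b \<notin> J" by blast+
      let ?C = "{r \<in> carrier R. r \<otimes> a \<in> J}"
      have "ideal ?C R"
        using colon_ideal[OF J'(1) ideal_subset[OF cgenideal_ideal[OF ab(1)]]]
        by (simp add: colon_PIdl[OF J'(1) ab(1)])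
      moreover have "J \<subseteq> ?C"
        using ideal_mult_right[OF J'(1) _ ab(1)] ideal_carrier[OF J'(1)] by blast
      moreover have "b \<in> ?C"
        using ab by (simp add: m_comm)
      ultimately obtain e where "length_le R ?C (carrier R) e"
        using good[of ?C] nab(2) by blast
      then have 1: "length_le R J (J <+> PIdl a) e"
        by (rule length_le_colon[OF J'(1) ab(1)])
      note Ja = ideal_insert[OF J'(1) ab(1) nab(1)]
      obtain e' where "length_le R (J <+> PIdl a) (carrier R) e'"
        using good[OF Ja] by blast
      then have "length_le R J (carrier R) (e + e')"
        using length_le_trans[OF 1 _ J'(1) Ja(1) oneideal] Ja(2) ideal_subset[OF Ja(1)] by blast
      then show False
        using J'(3) by blast
    qed
  qed
  then have "J = \<mm>"
    by (rule prime_nzd_maximal[OF dim _ w J'(2)])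
  have "length_le R \<mm> (carrier R) 1"
  proof (rule length_leI[where f = "\<lambda>K. if K = carrier R then 1 else 0"])
    fix K L
    assume KL: "ideal K R" "ideal L R" "\<mm> \<subseteq> K" "K \<subset> L" "L \<subseteq> carrier R"
    then have "L = carrier R"
      using maximalideal.I_maximal[OF maximal, of L] by blast
    then show "(if K = carrier R then 1 else 0) < (if L = carrier R then 1 else (0::nat))"
      using KL by auto
  qed simp
  then show False
    using J'(3) \<open>J = \<mm>\<close> by blast
qed

end

section \<open>Infinite families with generating infinite subfamilies\<close>

primrec horner :: "('a, 'b) ring_scheme \<Rightarrow> 'a list \<Rightarrow> 'a \<Rightarrow> 'a"
  where
    "horner R [] x = \<zero>\<^bsub>R\<^esub>"
  | "horner R (c # cs) x = c \<oplus>\<^bsub>R\<^esub> x \<otimes>\<^bsub>R\<^esub> horner R cs x"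

text \<open>Synthetic division: the coefficients of \<open>(p(X) - p(\<mu>)) / (X - \<mu>)\<close>.\<close>

primrec synthetic_div :: "('a, 'b) ring_scheme \<Rightarrow> 'a \<Rightarrow> 'a list \<Rightarrow> 'a list"
  where
    "synthetic_div R \<mu> [] = []"
  | "synthetic_div R \<mu> (c # cs) = (if cs = [] then [] else horner R cs \<mu> # synthetic_div R \<mu> cs)"

lemma length_synthetic_div: "length (synthetic_div R \<mu> cs) = length cs - 1"
  by (induction cs) (auto simp: Suc_diff_Suc neq_Nil_conv)

context cring
begin

lemma horner_in_ideal:
  assumes "ideal K R" "x \<in> carrier R" "set cs \<subseteq> K"
  shows "horner R cs x \<in> K"
  using assms(3)
  by (induction cs)
    (simp_all add: ideal_zero[OF assms(1)] ideal_add[OF assms(1)] ideal_mult_left[OF assms(1)] assms(2))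

lemma horner_closed: "x \<in> carrier R \<Longrightarrow> set cs \<subseteq> carrier R \<Longrightarrow> horner R cs x \<in> carrier R"
  by (rule horner_in_ideal[OF oneideal])

lemma set_synthetic_div:
  "\<mu> \<in> carrier R \<Longrightarrow> set cs \<subseteq> carrier R \<Longrightarrow> set (synthetic_div R \<mu> cs) \<subseteq> carrier R"
  by (induction cs) (simp_all add: horner_closed)

lemma horner_diff:
  assumes x: "x \<in> carrier R" and \<mu>: "\<mu> \<in> carrier R"
  shows "set cs \<subseteq> carrier R \<Longrightarrow>
    horner R cs x \<ominus> horner R cs \<mu> = (x \<ominus> \<mu>) \<otimes> horner R (synthetic_div R \<mu> cs) x"
proof (induction cs)
  case Nil
  show ?case
    using x \<mu> by (simp add: minus_eq)
next
  case (Cons c cs)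
  define A where "A = horner R cs x"
  define B where "B = horner R cs \<mu>"
  define Q where "Q = horner R (synthetic_div R \<mu> cs) x"
  have c: "c \<in> carrier R" "set cs \<subseteq> carrier R"
    using Cons.prems by auto
  have closed: "A \<in> carrier R" "B \<in> carrier R" "Q \<in> carrier R"
    unfolding A_def B_def Q_def using x \<mu> c(2) set_synthetic_div[OF \<mu> c(2)]
    by (simp_all add: horner_closed)
  have IH: "A \<ominus> B = (x \<ominus> \<mu>) \<otimes> Q"
    using Cons.IH[OF c(2)] by (simp only: A_def B_def Q_def)
  show ?case
  proof (cases "cs = []")
    case True
    then show ?thesis
      using x \<mu> c(1) by (simp add: minus_eq r_neg)
  next
    case False
    \<comment> \<open>Adding and subtracting x B splits off the induction hypothesis and leaves a
      second multiple of x - \<mu>.\<close>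
    have "(c \<oplus> x \<otimes> A) \<ominus> (c \<oplus> \<mu> \<otimes> B) = x \<otimes> (A \<ominus> B) \<oplus> (x \<ominus> \<mu>) \<otimes> B"
      using x \<mu> c(1) closed by algebra
    also have "\<dots> = (x \<ominus> \<mu>) \<otimes> (B \<oplus> x \<otimes> Q)"
      unfolding IH using x \<mu> closed by algebra
    finally show ?thesis
      using False by (simp add: A_def B_def Q_def)
  qed
qed

text \<open>Synthetic division can be undone: the head of the quotient is the value h of the tail at
  \<mu>, and the constant coefficient is p(\<mu>) - \<mu> h. So the quotient and p(\<mu>) determine
  all coefficients modulo K.\<close>

lemma synthetic_div_in_ideal:
  assumes K: "ideal K R" and \<mu>: "\<mu> \<in> carrier R"
  shows "set cs \<subseteq> carrier R \<Longrightarrow> set (synthetic_div R \<mu> cs) \<subseteq> K \<Longrightarrow> horner R cs \<mu> \<in> K \<Longrightarrow> set cs \<subseteq> K"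
proof (induction cs)
  case (Cons c cs)
  have c: "c \<in> carrier R" "set cs \<subseteq> carrier R"
    using Cons.prems by auto
  have h: "horner R cs \<mu> \<in> K"
    using Cons.prems(2) ideal_zero[OF K] by (cases "cs = []") auto
  have "set cs \<subseteq> K"
  proof (cases "cs = []")
    case False
    then show ?thesis
      using Cons.IH[OF c(2) _ h] Cons.prems(2) by simp
  qed simp
  moreover have "\<mu> \<otimes> horner R cs \<mu> \<oplus> c \<in> K"
    using Cons.prems(3) c \<mu> by (simp add: a_comm horner_closed)
  then have "c \<in> K"
    by (rule ideal_add_cancel[OF K ideal_mult_left[OF K h \<mu>] _ c(1)])
  ultimately show ?case by simp
qed simp

text \<open>This replaces a Vandermonde determinant. For x \<noteq> \<mu> in B the unit x - \<mu>
  cancels from p(x) - p(\<mu>), so the quotient by X - \<mu> takes values in K on the still infinite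
  set B without \<mu>, and induction on the number of coefficients applies.\<close>

lemma horner_infinite_in_ideal:
  assumes K: "ideal K R" and cs: "set cs \<subseteq> carrier R"
    and B: "infinite B" "B \<subseteq> carrier R"
    and inv: "\<And>x y. x \<in> B \<Longrightarrow> y \<in> B \<Longrightarrow> x \<noteq> y \<Longrightarrow> \<exists>s\<in>carrier R. s \<otimes> (x \<ominus> y) = \<one>"
    and mem: "\<And>x. x \<in> B \<Longrightarrow> horner R cs x \<in> K"
  shows "set cs \<subseteq> K"
  using cs B inv mem
proof (induction "length cs" arbitrary: cs B)
  case 0
  then show ?case by simp
next
  case (Suc n)
  obtain \<mu> where \<mu>: "\<mu> \<in> B"
    using Suc.prems(2) by fastforce
  then have \<mu>R: "\<mu> \<in> carrier R"
    using Suc.prems(3) by blast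
  let ?ds = "synthetic_div R \<mu> cs"
  have ds: "set ?ds \<subseteq> carrier R"
    by (rule set_synthetic_div[OF \<mu>R Suc.prems(1)])
  have "set ?ds \<subseteq> K"
  proof (rule Suc.hyps(1)[of ?ds "B - {\<mu>}"])
    show "n = length ?ds"
      using Suc.hyps(2) by (simp add: length_synthetic_div)
    fix x
    assume x: "x \<in> B - {\<mu>}"
    then have xR: "x \<in> carrier R"
      using Suc.prems(3) by blast
    obtain s where s: "s \<in> carrier R" "s \<otimes> (x \<ominus> \<mu>) = \<one>"
      using Suc.prems(4)[of x \<mu>] x \<mu> by blast
    have q: "horner R ?ds x \<in> carrier R"
      by (rule horner_closed[OF xR ds])
    have "horner R cs x \<ominus> horner R cs \<mu> \<in> K"
      unfolding minus_eq using x \<mu> by (intro ideal_add[OF K] ideal_uminus[OF K] Suc.prems(5)) auto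
    then have "s \<otimes> ((x \<ominus> \<mu>) \<otimes> horner R ?ds x) \<in> K"
      unfolding horner_diff[OF xR \<mu>R Suc.prems(1)] by (rule ideal_mult_left[OF K _ s(1)])
    then show "horner R ?ds x \<in> K"
      using s q xR \<mu>R by (simp add: m_assoc[symmetric])
  qed (use Suc.prems ds in auto)
  then show ?case
    using synthetic_div_in_ideal[OF K \<mu>R Suc.prems(1)] Suc.prems(5)[OF \<mu>] by blast
qed

end

text \<open>One representative is chosen from each residue class; the difference of two of them lies
  outside \<mm> and is therefore a unit.\<close>

lemma (in noetherian_local_ring) residue_representatives:
  assumes "infinite_residue_field R \<mm>"
  obtains \<Lambda> where "infinite \<Lambda>" "\<Lambda> \<subseteq> carrier R"
    "\<And>x y. x \<in> \<Lambda> \<Longrightarrow> y \<in> \<Lambda> \<Longrightarrow> x \<noteq> y \<Longrightarrow> \<exists>s\<in>carrier R. s \<otimes> (x \<ominus> y) = \<one>"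
proof -
  have "carrier (R Quot \<mm>) = (\<lambda>a. \<mm> +> a) ` carrier R"
    unfolding FactRing_def A_RCOSETS_def' by auto
  then obtain \<Lambda> where \<Lambda>: "\<Lambda> \<subseteq> carrier R" "inj_on (\<lambda>a. \<mm> +> a) \<Lambda>"
    "carrier (R Quot \<mm>) = (\<lambda>a. \<mm> +> a) ` \<Lambda>"
    using subset_image_inj[of "carrier (R Quot \<mm>)" "\<lambda>a. \<mm> +> a" "carrier R"] by auto
  show ?thesis
  proof (rule that)
    show "infinite \<Lambda>"
      using assms \<Lambda>(3) unfolding infinite_residue_field_def by auto
    fix x y
    assume xy: "x \<in> \<Lambda>" "y \<in> \<Lambda>" "x \<noteq> y"
    then have "x \<ominus> y \<notin> \<mm>"
      using quotient_eq_iff_same_a_r_cos[OF max_ideal, of x y] \<Lambda>(1,2) unfolding inj_on_def by blast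
    then show "\<exists>s\<in>carrier R. s \<otimes> (x \<ominus> y) = \<one>"
      using not_max_inverse[of "x \<ominus> y"] xy \<Lambda>(1) by blast
  qed fact
qed

text \<open>The family is a moment curve \<open>\<Sum>\<^sub>j c\<^sub>j \<nu>\<^sup>j\<close> through generators \<open>c\<^sub>j\<close>; it stands in for general
  linear combinations of the generators.\<close>

lemma (in noetherian_local_ring) generating_family:
  assumes "infinite_residue_field R \<mm>" and I: "ideal I R"
  obtains \<Lambda> :: "'a set" and l where "infinite \<Lambda>" "l ` \<Lambda> \<subseteq> I"
    "\<And>B K. B \<subseteq> \<Lambda> \<Longrightarrow> infinite B \<Longrightarrow> ideal K R \<Longrightarrow> l ` B \<subseteq> K \<Longrightarrow> I \<subseteq> K"
proof -
  obtain \<Lambda> where \<Lambda>: "infinite \<Lambda>" "\<Lambda> \<subseteq> carrier R"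
    "\<And>x y. x \<in> \<Lambda> \<Longrightarrow> y \<in> \<Lambda> \<Longrightarrow> x \<noteq> y \<Longrightarrow> \<exists>s\<in>carrier R. s \<otimes> (x \<ominus> y) = \<one>"
    using residue_representatives[OF assms(1)] by blast
  obtain A where A: "A \<subseteq> carrier R" "finite A" "I = Idl A"
    using finetely_gen[OF I] by blast
  obtain cs where cs: "set cs = A"
    using finite_list[OF A(2)] by blast
  show ?thesis
  proof (rule that[of \<Lambda> "horner R cs"])
    have "set cs \<subseteq> I"
      using genideal_self[OF A(1)] A(3) cs by simp
    then show "horner R cs ` \<Lambda> \<subseteq> I"
      using horner_in_ideal[OF I] \<Lambda>(2) by blast
    fix B K
    assume B: "B \<subseteq> \<Lambda>" "infinite B" and K: "ideal K R" "horner R cs ` B \<subseteq> K"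
    have "set cs \<subseteq> K"
    proof (rule horner_infinite_in_ideal[OF K(1) _ B(2)])
      show "set cs \<subseteq> carrier R" "B \<subseteq> carrier R"
        using cs A(1) B(1) \<Lambda>(2) by auto
      show "\<exists>s\<in>carrier R. s \<otimes> (x \<ominus> y) = \<one>" if "x \<in> B" "y \<in> B" "x \<noteq> y" for x y
        using \<Lambda>(3) that B(1) by blast
      show "horner R cs x \<in> K" if "x \<in> B" for x
        using K(2) that by blast
    qed
    then show "I \<subseteq> K"
      unfolding A(3) using genideal_minimal[OF K(1)] cs by simp
  qed fact
qed

section \<open>Principal reductions\<close>

text \<open>The case of one general element of the theorem of Eakin and Sathaye, following Green's proof
  of the hyperplane restriction theorem. If the claim fails for \<open>y\<close>, then for infinitely many
  \<open>\<nu>\<close> the submodule generated by \<open>y l\<^sub>\<nu> I\<^sup>d\<close> is proper, so that the induction hypothesis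
  applies to \<open>y l\<^sub>\<nu>\<close> and embeds it into the submodule belonging to almost every other \<open>\<nu>'\<close>. One
  of maximal rank then coincides with infinitely many others and is the whole module.\<close>

lemma (in cring) eakin_sathaye:
  fixes f :: "'a set \<Rightarrow> nat"
  assumes I: "ideal I R" and Z: "ideal Z R"
    and rank: "\<And>K L. ideal K R \<Longrightarrow> ideal L R \<Longrightarrow> Z \<subseteq> K \<Longrightarrow> K \<subset> L \<Longrightarrow> L \<subseteq> T \<Longrightarrow> f K < f L"
    and l: "l ` \<Lambda> \<subseteq> I"
    and gen: "\<And>B K. B \<subseteq> \<Lambda> \<Longrightarrow> infinite B \<Longrightarrow> ideal K R \<Longrightarrow> l ` B \<subseteq> K \<Longrightarrow> I \<subseteq> K"
  defines "W \<equiv> \<lambda>y d. (PIdl y) \<cdot> ideal_pow R I d <+> Z"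
  shows "y \<in> carrier R \<Longrightarrow> W y d \<subseteq> T \<Longrightarrow> f (W y d) \<le> d \<Longrightarrow>
    finite {\<nu>\<in>\<Lambda>. \<not> W y d \<subseteq> W (y \<otimes> l \<nu>) (d - 1)}"
proof -
  have pow: "ideal (ideal_pow R I d) R" for d
    by (rule ideal_pow_ideal[OF I])
  have yI: "ideal ((PIdl y) \<cdot> ideal_pow R I d) R" if "y \<in> carrier R" for y d
    by (rule ideal_prod_is_ideal[OF cgenideal_ideal[OF that] pow])
  have W_ideal: "ideal (W y d) R" if "y \<in> carrier R" for y d
    unfolding W_def by (rule add_ideals[OF yI[OF that] Z])
  have Z_W: "Z \<subseteq> W y d" if "y \<in> carrier R" for y d
    unfolding W_def by (rule set_add_upper(2)[OF yI[OF that] Z])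
  have mem_W: "y \<otimes> u \<in> W y d" if "y \<in> carrier R" "u \<in> ideal_pow R I d" for y u d
    using set_add_upper(1)[OF yI[OF that(1)] Z] PIdl_prod[OF that(1) pow] that(2)
    unfolding W_def by blast
  have W_le: "W y d \<subseteq> K"
    if "y \<in> carrier R" "ideal K R" "Z \<subseteq> K" "\<And>u. u \<in> ideal_pow R I d \<Longrightarrow> y \<otimes> u \<in> K" for y d K
    unfolding W_def PIdl_prod[OF that(1) pow] using that(4)
    by (intro set_add_least[OF that(2) _ that(3)]) blast
  have lR: "l \<nu> \<in> carrier R" "l \<nu> \<in> I" if "\<nu> \<in> \<Lambda>" for \<nu>
    using l that ideal_carrier[OF I] by blast+
  have W_Suc: "W (y \<otimes> l \<nu>) d \<subseteq> W y (Suc d)" if "y \<in> carrier R" "\<nu> \<in> \<Lambda>" for y \<nu> d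
  proof (rule W_le[OF _ W_ideal Z_W])
    fix u
    assume u: "u \<in> ideal_pow R I d"
    have "y \<otimes> l \<nu> \<otimes> u = y \<otimes> (l \<nu> \<otimes> u)"
      using that lR ideal_carrier[OF pow u] by (simp add: m_assoc)
    moreover have "l \<nu> \<otimes> u \<in> ideal_pow R I (Suc d)"
      unfolding ideal_pow_Suc[OF I] using lR(2)[OF that(2)] u by (rule ideal_prod.prod)
    ultimately show "y \<otimes> l \<nu> \<otimes> u \<in> W y (Suc d)"
      using mem_W[OF that(1)] by simp
  qed (use that lR in auto)
  have W_pred: "W (y \<otimes> l \<nu>) (d - 1) \<subseteq> W y d" if y: "y \<in> carrier R" "\<nu> \<in> \<Lambda>" for y \<nu> d
  proof (cases d)
    \<comment> \<open>Here \<open>d - 1\<close> is again 0, and the inclusion holds because I^0 is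
      the whole ring.\<close>
    case 0
    have "W (y \<otimes> l \<nu>) 0 \<subseteq> W y 0"
    proof (rule W_le[OF _ W_ideal Z_W])
      fix u
      assume "u \<in> ideal_pow R I 0"
      then have u: "u \<in> carrier R" by simp
      have "y \<otimes> l \<nu> \<otimes> u = y \<otimes> (l \<nu> \<otimes> u)"
        using y lR u by (simp add: m_assoc)
      then show "y \<otimes> l \<nu> \<otimes> u \<in> W y 0"
        using mem_W[OF y(1), of "l \<nu> \<otimes> u" 0] lR(1)[OF y(2)] u by simp
    qed (use y lR in auto)
    then show ?thesis
      using 0 by simp
  next
    case (Suc d')
    then show ?thesis
      using W_Suc[OF y] by simp
  qed
  show "y \<in> carrier R \<Longrightarrow> W y d \<subseteq> T \<Longrightarrow> f (W y d) \<le> d \<Longrightarrow>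
    finite {\<nu>\<in>\<Lambda>. \<not> W y d \<subseteq> W (y \<otimes> l \<nu>) (d - 1)}"
  proof (induction d arbitrary: y)
    case 0
    \<comment> \<open>An ideal strictly above Z has positive rank, so rank 0 forces
      \<open>W y 0\<close> down to Z, which lies in every \<open>W\<close>.\<close>
    have "W y 0 \<subseteq> Z"
      using rank[OF Z W_ideal[OF 0(1)] subset_refl, of 0] Z_W[OF 0(1), of 0] 0(2,3) by auto
    then have "W y 0 \<subseteq> W (y \<otimes> l \<nu>) (0 - 1)" if "\<nu> \<in> \<Lambda>" for \<nu>
      using Z_W[of "y \<otimes> l \<nu>" "0 - 1"] 0(1) lR(1)[OF that] by (meson m_closed subset_trans)
    then have "{\<nu>\<in>\<Lambda>. \<not> W y 0 \<subseteq> W (y \<otimes> l \<nu>) (0 - 1)} = {}"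
      by blast
    then show ?case
      by (metis finite.emptyI)
  next
    case (Suc d)
    note y = Suc.prems(1)
    define V where "V \<nu> = W (y \<otimes> l \<nu>) d" for \<nu>
    define Bad where "Bad = {\<nu>\<in>\<Lambda>. \<not> W y (Suc d) \<subseteq> V \<nu>}"
    have yl: "y \<otimes> l \<nu> \<in> carrier R" if "\<nu> \<in> \<Lambda>" for \<nu>
      using y lR(1)[OF that] by simp
    have V: "ideal (V \<nu>) R" "Z \<subseteq> V \<nu>" if "\<nu> \<in> \<Lambda>" for \<nu>
      unfolding V_def using W_ideal[OF yl[OF that]] Z_W[OF yl[OF that]] by blast+
    have V_T: "V \<nu> \<subseteq> T" if "\<nu> \<in> \<Lambda>" for \<nu>
      using W_Suc[OF y that] Suc.prems(2) unfolding V_def by blast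
    have V_rank: "f (V \<nu>) \<le> d" if "\<nu> \<in> Bad" for \<nu>
    proof -
      have "\<nu> \<in> \<Lambda>" "V \<nu> \<subset> W y (Suc d)"
        using that W_Suc[OF y, of \<nu> d] unfolding Bad_def V_def by blast+
      then have "f (V \<nu>) < f (W y (Suc d))"
        using rank[OF V(1) W_ideal[OF y] V(2)] Suc.prems(2) by blast
      then show ?thesis
        using Suc.prems(3) by linarith
    qed
    have almost: "finite {\<nu>'\<in>\<Lambda>. \<not> V \<nu> \<subseteq> V \<nu>'}" if \<nu>: "\<nu> \<in> Bad" for \<nu>
    proof (rule finite_subset)
      have \<nu>\<Lambda>: "\<nu> \<in> \<Lambda>"
        using \<nu> unfolding Bad_def by blast
      show "finite {\<nu>'\<in>\<Lambda>. \<not> W (y \<otimes> l \<nu>) d \<subseteq> W (y \<otimes> l \<nu> \<otimes> l \<nu>') (d - 1)}"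
        using Suc.IH[OF yl[OF \<nu>\<Lambda>]] V_T[OF \<nu>\<Lambda>] V_rank[OF \<nu>] unfolding V_def by blast
      \<comment> \<open>Commutativity: the ideal that the induction hypothesis attaches to \<nu>
        followed by \<nu>' also arises from \<nu>' followed by \<nu>, hence lies in
        \<open>V \<nu>'\<close>.\<close>
      have "W (y \<otimes> l \<nu> \<otimes> l \<nu>') (d - 1) \<subseteq> V \<nu>'" if "\<nu>' \<in> \<Lambda>" for \<nu>'
      proof -
        have "y \<otimes> l \<nu> \<otimes> l \<nu>' = y \<otimes> l \<nu>' \<otimes> l \<nu>"
          using y lR(1)[OF that] lR(1)[OF \<nu>\<Lambda>] by (simp add: m_ac)
        then show ?thesis
          unfolding V_def using W_pred[OF yl[OF that] \<nu>\<Lambda>] by simp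
      qed
      then show "{\<nu>'\<in>\<Lambda>. \<not> V \<nu> \<subseteq> V \<nu>'}
        \<subseteq> {\<nu>'\<in>\<Lambda>. \<not> W (y \<otimes> l \<nu>) d \<subseteq> W (y \<otimes> l \<nu> \<otimes> l \<nu>') (d - 1)}"
        unfolding V_def by blast
    qed
    have "finite Bad"
    proof (rule ccontr)
      assume inf: "infinite Bad"
      then obtain \<nu>\<^sub>1 where "\<nu>\<^sub>1 \<in> Bad"
        by fastforce
      then obtain \<nu> where \<nu>: "\<nu> \<in> Bad" and max: "\<And>\<nu>'. \<nu>' \<in> Bad \<Longrightarrow> f (V \<nu>') \<le> f (V \<nu>)"
        using ex_has_greatest_nat[of "\<lambda>\<nu>. \<nu> \<in> Bad" \<nu>\<^sub>1 "\<lambda>\<nu>. f (V \<nu>)" "Suc d"] V_rank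
        by (metis less_Suc_eq_le)
      have \<nu>\<Lambda>: "\<nu> \<in> \<Lambda>"
        using \<nu> unfolding Bad_def by blast
      \<comment> \<open>These are the bad indices whose submodule contains the one of maximal rank;
        maximality then forces equality.\<close>
      define B where "B = Bad - {\<nu>'\<in>\<Lambda>. \<not> V \<nu> \<subseteq> V \<nu>'}"
      have "infinite B"
        unfolding B_def using inf almost[OF \<nu>] by simp
      have B: "\<nu>' \<in> \<Lambda>" "V \<nu>' = V \<nu>" if "\<nu>' \<in> B" for \<nu>'
      proof -
        show *: "\<nu>' \<in> \<Lambda>"
          using that unfolding B_def Bad_def by blast
        have "V \<nu> \<subseteq> V \<nu>'" "f (V \<nu>') \<le> f (V \<nu>)"
          using that max unfolding B_def Bad_def by blast+
        then show "V \<nu>' = V \<nu>"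
          using rank[OF V(1)[OF \<nu>\<Lambda>] V(1)[OF *] V(2)[OF \<nu>\<Lambda>]] V_T[OF *] by force
      qed
      \<comment> \<open>K consists of the multipliers that carry y I^d into \<open>V \<nu>\<close>.
        It contains \<open>l \<nu>'\<close> for all \<nu>' in B because
        \<open>V \<nu>' = V \<nu>\<close>, hence all of I, so y I^(d+1) lies in
        \<open>V \<nu>\<close> and \<nu> is not bad.\<close>
      define K where "K = colon R (V \<nu>) ((PIdl y) \<cdot> ideal_pow R I d)"
      have "I \<subseteq> K"
      proof (rule gen[OF _ \<open>infinite B\<close>])
        show "B \<subseteq> \<Lambda>"
          using B(1) by blast
        show "ideal K R"
          unfolding K_def by (rule colon_ideal[OF V(1)[OF \<nu>\<Lambda>] ideal_subset[OF yI[OF y]]])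
        show "l ` B \<subseteq> K"
        proof
          fix z
          assume "z \<in> l ` B"
          then obtain \<nu>' where \<nu>': "\<nu>' \<in> B" "z = l \<nu>'" by blast
          have "l \<nu>' \<otimes> (y \<otimes> u) \<in> V \<nu>" if u: "u \<in> ideal_pow R I d" for u
          proof -
            have "l \<nu>' \<otimes> (y \<otimes> u) = y \<otimes> l \<nu>' \<otimes> u"
              using y lR(1)[OF B(1)[OF \<nu>'(1)]] ideal_carrier[OF pow u] by (simp add: m_ac)
            then have "l \<nu>' \<otimes> (y \<otimes> u) \<in> V \<nu>'"
              unfolding V_def using mem_W[OF yl[OF B(1)[OF \<nu>'(1)]] u] by simp
            then show ?thesis
              using B(2)[OF \<nu>'(1)] by simp
          qed
          then show "z \<in> K"
            unfolding K_def colon_def PIdl_prod[OF y pow] \<nu>'(2)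
            using lR(1)[OF B(1)[OF \<nu>'(1)]] by blast
        qed
      qed
      have "W y (Suc d) \<subseteq> V \<nu>"
      proof (rule W_le[OF y V[OF \<nu>\<Lambda>]])
        fix u
        assume u: "u \<in> ideal_pow R I (Suc d)"
        have "ideal_pow R I (Suc d) \<subseteq> colon R (V \<nu>) (PIdl y)"
          unfolding ideal_pow_Suc[OF I]
        proof (rule ideal_prod_le)
          show "ideal (colon R (V \<nu>) (PIdl y)) R"
            by (rule colon_ideal[OF V(1)[OF \<nu>\<Lambda>] ideal_subset[OF cgenideal_ideal[OF y]]])
          fix a b
          assume a: "a \<in> I" and b: "b \<in> ideal_pow R I d"
          have "a \<otimes> (y \<otimes> b) \<in> V \<nu>"
            using \<open>I \<subseteq> K\<close> a b unfolding K_def colon_def PIdl_prod[OF y pow] by blast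
          moreover have "a \<otimes> b \<otimes> y = a \<otimes> (y \<otimes> b)"
            using ideal_carrier[OF I a] ideal_carrier[OF pow b] y by (simp add: m_ac)
          ultimately show "a \<otimes> b \<in> colon R (V \<nu>) (PIdl y)"
            unfolding colon_PIdl[OF V(1)[OF \<nu>\<Lambda>] y]
            using ideal_carrier[OF I a] ideal_carrier[OF pow b] by simp
        qed
        then have "u \<otimes> y \<in> V \<nu>"
          using u unfolding colon_PIdl[OF V(1)[OF \<nu>\<Lambda>] y] by blast
        then show "y \<otimes> u \<in> V \<nu>"
          using m_comm[OF y ideal_carrier[OF pow u]] by simp
      qed
      then show False
        using \<nu> unfolding Bad_def by blast
    qed
    then show ?case
      unfolding Bad_def V_def by simp
  qed
qed

context noetherian_local_ring
begin

section \<open>Powers of \<mm> along a reduction, and passage to a principal one\<close>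

lemma max_pow: "ideal (ideal_pow R \<mm> n) R"
  by (rule ideal_pow_ideal[OF max_ideal])

lemma reduction_step:
  assumes I: "ideal I R" and r: "I \<cdot> ideal_pow R \<mm> r = ideal_pow R \<mm> (r + 1)" and "r \<le> n"
  shows "I \<cdot> ideal_pow R \<mm> n = ideal_pow R \<mm> (n + 1)"
proof -
  have "I \<cdot> ideal_pow R \<mm> (r + (n - r)) = (I \<cdot> ideal_pow R \<mm> r) \<cdot> ideal_pow R \<mm> (n - r)"
    by (simp only: ideal_pow_add[OF max_ideal] ideal_prod_assoc[OF I max_pow max_pow])
  also have "\<dots> = ideal_pow R \<mm> (r + 1 + (n - r))"
    by (simp only: r ideal_pow_add[OF max_ideal])
  finally show ?thesis
    using \<open>r \<le> n\<close> by (simp del: nat_pow_Suc)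
qed

lemma reduction_pow:
  assumes I: "ideal I R" and r: "I \<cdot> ideal_pow R \<mm> r = ideal_pow R \<mm> (r + 1)"
  shows "ideal_pow R I n \<cdot> ideal_pow R \<mm> r = ideal_pow R \<mm> (n + r)"
proof (induction n)
  case 0
  show ?case
    using ideal_prod_commute[OF oneideal max_pow] ideal_prod_one[OF max_pow] by simp
next
  case (Suc n)
  have "ideal_pow R I (Suc n) \<cdot> ideal_pow R \<mm> r = I \<cdot> ideal_pow R \<mm> (n + r)"
    unfolding ideal_pow_Suc[OF I] ideal_prod_assoc[OF I ideal_pow_ideal[OF I] max_pow] Suc ..
  also have "\<dots> = ideal_pow R \<mm> (n + r + 1)"
    by (rule reduction_step[OF I r]) simp
  finally show ?case by simp
qed

lemma exists_principal_reduction: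
  assumes dim: "krull_dim R \<le> 1" and w: "nonzerodivisor R w" "w \<in> \<mm>"
    and res: "infinite_residue_field R \<mm>" and red: "reduction R \<mm> I"
  shows "\<exists>x\<in>I. reduction R \<mm> (PIdl x)"
proof -
  have I: "ideal I R" "I \<subseteq> \<mm>"
    using red unfolding reduction_def by blast+
  obtain r where r: "I \<cdot> ideal_pow R \<mm> r = ideal_pow R \<mm> (r + 1)"
    using red unfolding reduction_def by blast
  have wR: "w \<in> carrier R"
    using w(1) unfolding nonzerodivisor_def by blast
  obtain e where e: "length_le R (PIdl w) (carrier R) e"
    using length_le_quotient_nzd[OF dim w(1)] by blast
  \<comment> \<open>The exponent \<open>Suc e\<close> meets the rank bound of
    \<open>eakin_sathaye\<close> and has the genuine predecessor e.\<close>
  define T where "T = ideal_pow R I (Suc e)"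
  define Z where "Z = (PIdl w) \<cdot> T"
  have T: "ideal T R"
    unfolding T_def by (rule ideal_pow_ideal[OF I(1)])
  have Z: "ideal Z R"
    unfolding Z_def by (rule ideal_prod_is_ideal[OF cgenideal_ideal[OF wR] T])
  \<comment> \<open>A power of \<mm>, and with it a power of w, lies in T; this is what bounds the
    length of T/wT by e.\<close>
  have "ideal_pow R \<mm> (Suc e + r) \<subseteq> T"
    unfolding reduction_pow[OF I(1) r, symmetric] T_def
    using ideal_prod_inter[OF ideal_pow_ideal[OF I(1)] max_pow] by blast
  then have "w [^] (Suc e + r) \<in> T"
    using pow_in_ideal_pow[OF w(2)] by blast
  then have "length_le R Z T e"
    unfolding Z_def by (rule length_le_mult_nzd[OF w(1) e T])
  then obtain f where f: "f T \<le> e"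
    "\<And>K L. ideal K R \<Longrightarrow> ideal L R \<Longrightarrow> Z \<subseteq> K \<Longrightarrow> K \<subset> L \<Longrightarrow> L \<subseteq> T \<Longrightarrow> (f K :: nat) < f L"
    by (rule length_leE) blast
  obtain \<Lambda> :: "'a set" and l where \<Lambda>: "infinite \<Lambda>" "l ` \<Lambda> \<subseteq> I"
    "\<And>B K. B \<subseteq> \<Lambda> \<Longrightarrow> infinite B \<Longrightarrow> ideal K R \<Longrightarrow> l ` B \<subseteq> K \<Longrightarrow> I \<subseteq> K"
    using generating_family[OF res I(1)] by blast
  have PIdl_one: "PIdl \<one> = carrier R"
    using cgenideal_eq_genideal genideal_one by simp
  have "Z \<subseteq> T"
    unfolding Z_def using ideal_prod_inter[OF cgenideal_ideal[OF wR] T] by blast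
  have W1: "(PIdl \<one>) \<cdot> ideal_pow R I (Suc e) <+> Z = T"
  proof -
    have "(PIdl \<one>) \<cdot> ideal_pow R I (Suc e) = T"
      unfolding PIdl_one T_def[symmetric]
      using ideal_prod_commute[OF oneideal T] ideal_prod_one[OF T] by simp
    then show ?thesis
      using set_add_least[OF T subset_refl \<open>Z \<subseteq> T\<close>] set_add_upper(1)[OF T Z] by auto
  qed
  have "finite {\<nu>\<in>\<Lambda>. \<not> (PIdl \<one>) \<cdot> ideal_pow R I (Suc e) <+> Z
      \<subseteq> (PIdl (\<one> \<otimes> l \<nu>)) \<cdot> ideal_pow R I (Suc e - 1) <+> Z}"
  proof (rule eakin_sathaye[where f = f and T = T, OF I(1) Z f(2) \<Lambda>(2,3) one_closed])
    show "(PIdl \<one>) \<cdot> ideal_pow R I (Suc e) <+> Z \<subseteq> T"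
      "f ((PIdl \<one>) \<cdot> ideal_pow R I (Suc e) <+> Z) \<le> Suc e"
      unfolding W1 using f(1) by auto
  qed
  then have "finite {\<nu>\<in>\<Lambda>. \<not> T \<subseteq> (PIdl (\<one> \<otimes> l \<nu>)) \<cdot> ideal_pow R I (Suc e - 1) <+> Z}"
    (is "finite ?Bad")
    by (simp only: W1)
  then have "\<Lambda> - ?Bad \<noteq> {}"
    by (intro infinite_imp_nonempty Diff_infinite_finite \<Lambda>(1))
  then obtain \<nu> where \<nu>: "\<nu> \<in> \<Lambda>" "T \<subseteq> (PIdl (\<one> \<otimes> l \<nu>)) \<cdot> ideal_pow R I (Suc e - 1) <+> Z"
    by blast
  define x where "x = l \<nu>"
  have x: "x \<in> I" "x \<in> carrier R" "x \<in> \<mm>"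
    unfolding x_def using \<nu>(1) \<Lambda>(2) I ideal_carrier[OF I(1)] by blast+
  define Q where "Q = PIdl x"
  have Q: "ideal Q R" "Q \<subseteq> \<mm>"
    unfolding Q_def using cgenideal_ideal[OF x(2)] cgenideal_minimal[OF max_ideal x(3)] by blast+
  have Ie: "ideal (ideal_pow R I e) R"
    by (rule ideal_pow_ideal[OF I(1)])
  have QI: "ideal (Q \<cdot> ideal_pow R I e) R"
    by (rule ideal_prod_is_ideal[OF Q(1) Ie])
  \<comment> \<open>Since w lies in \<mm>, the error term wT is absorbed by Nakayama's
    lemma.\<close>
  have "Z \<subseteq> \<mm> \<cdot> T"
    unfolding Z_def using cgenideal_minimal[OF max_ideal w(2)] by (rule ideal_prod_mono) simp
  then have "Q \<cdot> ideal_pow R I e <+> Z \<subseteq> Q \<cdot> ideal_pow R I e <+> \<mm> \<cdot> T"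
    unfolding subset_iff set_add_iff by blast
  moreover have "T \<subseteq> Q \<cdot> ideal_pow R I e <+> Z"
    using \<nu>(2) x(2) unfolding Q_def x_def by simp
  ultimately have "T \<subseteq> Q \<cdot> ideal_pow R I e"
    using nakayama[OF T QI] by blast
  \<comment> \<open>Multiplying by \<mm>^r turns powers of I into powers of \<mm>, so a statement on
    reductions of I becomes one on reductions of \<mm>.\<close>
  then have "T \<cdot> ideal_pow R \<mm> r \<subseteq> (Q \<cdot> ideal_pow R I e) \<cdot> ideal_pow R \<mm> r"
    by (rule ideal_prod_mono) simp
  moreover have "T \<cdot> ideal_pow R \<mm> r = ideal_pow R \<mm> (e + r + 1)"
    unfolding T_def reduction_pow[OF I(1) r] by simp
  moreover have "(Q \<cdot> ideal_pow R I e) \<cdot> ideal_pow R \<mm> r = Q \<cdot> ideal_pow R \<mm> (e + r)"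
    unfolding ideal_prod_assoc[OF Q(1) Ie max_pow] reduction_pow[OF I(1) r] ..
  moreover have "Q \<cdot> ideal_pow R \<mm> (e + r) \<subseteq> ideal_pow R \<mm> (e + r + 1)"
    using ideal_prod_mono[OF Q(2) subset_refl, of "ideal_pow R \<mm> (e + r)"]
    by (simp only: ideal_pow_Suc[OF max_ideal] Suc_eq_plus1[symmetric])
  ultimately have "Q \<cdot> ideal_pow R \<mm> (e + r) = ideal_pow R \<mm> (e + r + 1)"
    by simp
  then have "reduction R \<mm> Q"
    unfolding reduction_def using Q by blast
  then show ?thesis
    unfolding Q_def using x(1) by blast
qed

text \<open>A power of w lies in \<mm>^(r+1) = x \<mm>^r and is thus a multiple of x; a divisor of a
  non-zero-divisor is a non-zero-divisor.\<close>

lemma principal_reduction_nzd: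
  assumes w: "nonzerodivisor R w" "w \<in> \<mm>" and x: "x \<in> carrier R" and red: "reduction R \<mm> (PIdl x)"
  shows "nonzerodivisor R x"
proof -
  obtain r where "(PIdl x) \<cdot> ideal_pow R \<mm> r = ideal_pow R \<mm> (r + 1)"
    using red unfolding reduction_def by blast
  then have "w [^] (r + 1) \<in> PIdl x"
    using pow_in_ideal_pow[OF w(2), of "r + 1"] ideal_prod_inter[OF cgenideal_ideal[OF x] max_pow, of r]
    by auto
  then obtain s where s: "s \<in> carrier R" "w [^] (r + 1) = s \<otimes> x"
    unfolding cgenideal_def by blast
  show ?thesis
    unfolding nonzerodivisor_def
  proof (intro conjI ballI impI)
    fix y
    assume y: "y \<in> carrier R" "x \<otimes> y = \<zero>"
    have "w [^] (r + 1) \<otimes> y = s \<otimes> (x \<otimes> y)"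
      unfolding s(2) using s(1) x y(1) by (rule m_assoc)
    also have "\<dots> = \<zero>"
      using s(1) y(2) by simp
    finally show "y = \<zero>"
      using nzd_pow[OF w(1), of "r + 1"] y(1) unfolding nonzerodivisor_def by blast
  qed fact
qed

lemma minimal_reduction_principal:
  assumes dim: "krull_dim R \<le> 1" and w: "nonzerodivisor R w" "w \<in> \<mm>"
    and res: "infinite_residue_field R \<mm>" and I: "minimal_reduction R \<mm> I"
  obtains x where "nonzerodivisor R x" "x \<in> \<mm>" "I = PIdl x" "reduction R \<mm> (PIdl x)"
proof -
  have red: "reduction R \<mm> I"
    using I unfolding minimal_reduction_def by blast
  have ideal: "ideal I R" "I \<subseteq> \<mm>"
    using red unfolding reduction_def by blast+
  obtain x where x: "x \<in> I" "reduction R \<mm> (PIdl x)"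
    using exists_principal_reduction[OF dim w res red] by blast
  have "PIdl x \<subseteq> I"
    by (rule cgenideal_minimal[OF ideal(1) x(1)])
  then have "I = PIdl x"
    using I x(2) unfolding minimal_reduction_def by blast
  moreover have "nonzerodivisor R x"
    by (rule principal_reduction_nzd[OF w ideal_carrier[OF ideal(1) x(1)] x(2)])
  ultimately show ?thesis
    using that x ideal(2) by blast
qed

section \<open>Comparison of two principal reductions\<close>

lemma PIdl_nzd_cancel:
  assumes "nonzerodivisor R a" "ideal A R" "ideal B R" "(PIdl a) \<cdot> A = (PIdl a) \<cdot> B"
  shows "A = B"
proof -
  have "A = {r \<in> carrier R. r \<otimes> a \<in> (PIdl a) \<cdot> A}"
    by (rule colon_nzd_prod[OF assms(1,2), symmetric])
  also have "\<dots> = B"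
    unfolding assms(4) by (rule colon_nzd_prod[OF assms(1,3)])
  finally show ?thesis .
qed

lemma PIdl_reduction_pow:
  assumes x: "x \<in> carrier R" and r: "(PIdl x) \<cdot> ideal_pow R \<mm> r = ideal_pow R \<mm> (r + 1)"
  shows "(PIdl (x [^] k)) \<cdot> ideal_pow R \<mm> r = ideal_pow R \<mm> (k + r)"
proof (induction k)
  case 0
  have "PIdl \<one> = carrier R"
    using cgenideal_eq_genideal genideal_one by simp
  then show ?case
    using ideal_prod_commute[OF oneideal max_pow] ideal_prod_one[OF max_pow] by simp
next
  case (Suc k)
  have P: "ideal (PIdl x) R" "ideal (PIdl (x [^] k)) R"
    using x by (simp_all add: cgenideal_ideal)
  have "(PIdl (x [^] Suc k)) \<cdot> ideal_pow R \<mm> r = (PIdl x) \<cdot> ideal_pow R \<mm> (k + r)"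
    unfolding PIdl_pow_Suc[OF x] ideal_prod_assoc[OF P max_pow] Suc ..
  also have "\<dots> = ideal_pow R \<mm> (k + r + 1)"
    by (rule reduction_step[OF P(1) r]) simp
  finally show ?case by simp
qed

text \<open>Here \<open>\<mm>\<^sup>k\<^sup>+\<^sup>r = x\<^sup>k \<mm>\<^sup>r\<close>, and \<open>x\<^sup>k\<close> can be
  cancelled from \<open>y \<mm>\<^sup>k\<^sup>+\<^sup>r = \<mm>\<^sup>k\<^sup>+\<^sup>r\<^sup>+\<^sup>1\<close>.\<close>

lemma reduction_exponent_independent:
  assumes x: "nonzerodivisor R x" and y: "y \<in> carrier R" "reduction R \<mm> (PIdl y)"
    and r: "(PIdl x) \<cdot> ideal_pow R \<mm> r = ideal_pow R \<mm> (r + 1)"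
  shows "(PIdl y) \<cdot> ideal_pow R \<mm> r = ideal_pow R \<mm> (r + 1)"
proof -
  have xR: "x \<in> carrier R"
    using x unfolding nonzerodivisor_def by blast
  obtain k where k: "(PIdl y) \<cdot> ideal_pow R \<mm> k = ideal_pow R \<mm> (k + 1)"
    using y(2) unfolding reduction_def by blast
  \<comment> \<open>With x^k as multiplier, the exponent k + r is at least k, where y is already
    known to carry one power of \<mm> onto the next.\<close>
  define Q where "Q = PIdl (x [^] k)"
  have P: "ideal Q R" "ideal (PIdl y) R"
    unfolding Q_def using xR y(1) by (simp_all add: cgenideal_ideal)
  have r': "(PIdl x) \<cdot> ideal_pow R \<mm> (r + 1) = ideal_pow R \<mm> (r + 1 + 1)"
    by (rule reduction_step[OF cgenideal_ideal[OF xR] r]) simp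
  have "Q \<cdot> ((PIdl y) \<cdot> ideal_pow R \<mm> r) = (PIdl y) \<cdot> (Q \<cdot> ideal_pow R \<mm> r)"
    unfolding ideal_prod_assoc[OF P max_pow, symmetric]
      ideal_prod_assoc[OF P(2,1) max_pow, symmetric] ideal_prod_commute[OF P] ..
  also have "\<dots> = (PIdl y) \<cdot> ideal_pow R \<mm> (k + r)"
    unfolding Q_def PIdl_reduction_pow[OF xR r] ..
  also have "\<dots> = ideal_pow R \<mm> (k + r + 1)"
    by (rule reduction_step[OF P(2) k]) simp
  also have "\<dots> = Q \<cdot> ideal_pow R \<mm> (r + 1)"
    unfolding Q_def PIdl_reduction_pow[OF xR r'] by (simp only: add.assoc)
  finally show ?thesis
    unfolding Q_def
    by (rule PIdl_nzd_cancel[OF nzd_pow[OF x] ideal_prod_is_ideal[OF P(2) max_pow] max_pow])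
qed

section \<open>Fullness of the ideals \<open>x \<mm>\<^sup>n\<close>\<close>

text \<open>As x lies in \<mm>, the ideal (J\<mm> : \<mm>) is squeezed between J and (J\<mm> : x) =
  J.\<close>

lemma m_full_imp_weakly_m_full:
  assumes J: "ideal J R" and full: "m_full R \<mm> J"
  shows "weakly_m_full R \<mm> J"
proof -
  obtain x where x: "x \<in> \<mm>" "colon R (J \<cdot> \<mm>) (PIdl x) = J"
    using full unfolding m_full_def by blast
  have "PIdl x \<subseteq> \<mm>"
    by (rule cgenideal_minimal[OF max_ideal x(1)])
  then have "colon R (J \<cdot> \<mm>) \<mm> \<subseteq> colon R (J \<cdot> \<mm>) (PIdl x)"
    unfolding colon_def by blast
  moreover have "J \<subseteq> colon R (J \<cdot> \<mm>) \<mm>"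
    unfolding colon_def using ideal_carrier[OF J] by (auto intro: ideal_prod.prod)
  ultimately show ?thesis
    unfolding weakly_m_full_def x(2) by blast
qed

text \<open>Otherwise \<mm>^(n+1) = x \<mm>^n would lie in \<mm>^(n+2) and vanish by Nakayama's
  lemma, although it contains the non-zero-divisor x^(n+1). This qualifies x as a witness in
  \<open>m_full\<close> and \<open>full\<close>.\<close>

lemma principal_reduction_notin_square:
  assumes x: "nonzerodivisor R x" "x \<in> \<mm>"
    and n: "(PIdl x) \<cdot> ideal_pow R \<mm> n = ideal_pow R \<mm> (n + 1)"
  shows "x \<notin> ideal_pow R \<mm> 2"
proof
  assume "x \<in> ideal_pow R \<mm> 2"
  then have "PIdl x \<subseteq> ideal_pow R \<mm> 2"
    by (rule cgenideal_minimal[OF max_pow])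
  then have "ideal_pow R \<mm> (n + 1) \<subseteq> ideal_pow R \<mm> 2 \<cdot> ideal_pow R \<mm> n"
    unfolding n[symmetric] by (rule ideal_prod_mono) simp
  also have "\<dots> = ideal_pow R \<mm> (Suc (n + 1))"
    unfolding ideal_pow_add[OF max_ideal, symmetric] by (simp del: nat_pow_Suc)
  also have "\<dots> = \<mm> \<cdot> ideal_pow R \<mm> (n + 1)"
    by (rule ideal_pow_Suc[OF max_ideal])
  also have "\<dots> \<subseteq> {\<zero>} <+> \<mm> \<cdot> ideal_pow R \<mm> (n + 1)"
    by (rule set_add_upper(2)[OF zeroideal ideal_prod_is_ideal[OF max_ideal max_pow]])
  finally have "ideal_pow R \<mm> (n + 1) \<subseteq> {\<zero>}"
    by (rule nakayama[OF max_pow zeroideal])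
  then have "x [^] (n + 1) = \<zero>"
    using pow_in_ideal_pow[OF x(2), of "n + 1"] by blast
  then have "\<one> = \<zero>"
    using nzd_pow[OF x(1), of "n + 1"] unfolding nonzerodivisor_def by auto
  then show False
    using one_notin_max ideal_zero[OF max_ideal] by simp
qed

context
  fixes x :: 'a and n :: nat
  assumes x: "nonzerodivisor R x" "x \<in> \<mm>"
    and n: "(PIdl x) \<cdot> ideal_pow R \<mm> n = ideal_pow R \<mm> (n + 1)"
begin

lemma principal_carrier: "x \<in> carrier R"
  by (rule ideal_carrier[OF max_ideal x(2)])

text \<open>Cancelling x from x \<mm>^(n+1) leaves \<mm>^(n+1), which is x \<mm>^n again by the
  choice of n.\<close>

lemma principal_m_full: "m_full R \<mm> ((PIdl x) \<cdot> ideal_pow R \<mm> n)"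
proof -
  have P: "ideal (PIdl x) R"
    by (rule cgenideal_ideal[OF principal_carrier])
  have "(PIdl x) \<cdot> ideal_pow R \<mm> n \<cdot> \<mm> = (PIdl x) \<cdot> ideal_pow R \<mm> (n + 1)"
    unfolding ideal_prod_assoc[OF P max_pow max_ideal] by simp
  moreover have "colon R ((PIdl x) \<cdot> ideal_pow R \<mm> (n + 1)) (PIdl x) = ideal_pow R \<mm> (n + 1)"
    unfolding colon_PIdl[OF ideal_prod_is_ideal[OF P max_pow] principal_carrier]
    by (rule colon_nzd_prod[OF x(1) max_pow])
  ultimately show ?thesis
    unfolding m_full_def using principal_reduction_notin_square[OF x n] x(2) n by auto
qed

text \<open>The colon by x is \<mm>^n, and \<mm>^n carries \<mm> into \<mm>^(n+1) = x \<mm>^n; the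
  other inclusion holds because x lies in \<mm>.\<close>

lemma principal_full: "full R \<mm> ((PIdl x) \<cdot> ideal_pow R \<mm> n)"
proof -
  let ?J = "(PIdl x) \<cdot> ideal_pow R \<mm> n"
  have "ideal ?J R"
    by (rule ideal_prod_is_ideal[OF cgenideal_ideal[OF principal_carrier] max_pow])
  then have "colon R ?J (PIdl x) = ideal_pow R \<mm> n"
    using colon_nzd_prod[OF x(1) max_pow] by (simp only: colon_PIdl[OF _ principal_carrier])
  moreover have "ideal_pow R \<mm> n \<subseteq> colon R ?J \<mm>"
    unfolding n colon_def using ideal_carrier[OF max_pow] by (auto intro: ideal_prod.prod)
  moreover have "colon R ?J \<mm> \<subseteq> colon R ?J (PIdl x)"
    using cgenideal_minimal[OF max_ideal x(2)] unfolding colon_def by blast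
  ultimately have "colon R ?J (PIdl x) = colon R ?J \<mm>"
    by blast
  then show ?thesis
    unfolding full_def using principal_reduction_notin_square[OF x n] x(2) by blast
qed

end

text \<open>The ideals I \<mm>^n and \<mm>^(n+1) have the same product with \<mm>, so \<mm>^(n+1)
  lies in the colon that weak fullness identifies with I \<mm>^n.\<close>

lemma weakly_m_full_descend:
  assumes I: "ideal I R" "I \<subseteq> \<mm>"
    and weak: "weakly_m_full R \<mm> (I \<cdot> ideal_pow R \<mm> n)"
    and n: "I \<cdot> ideal_pow R \<mm> (n + 1) = ideal_pow R \<mm> (n + 1 + 1)"
  shows "I \<cdot> ideal_pow R \<mm> n = ideal_pow R \<mm> (n + 1)"
proof
  show "I \<cdot> ideal_pow R \<mm> n \<subseteq> ideal_pow R \<mm> (n + 1)"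
    using ideal_prod_mono[OF I(2) subset_refl] ideal_pow_Suc[OF max_ideal] by simp
  have eq: "I \<cdot> ideal_pow R \<mm> n \<cdot> \<mm> = ideal_pow R \<mm> (n + 1) \<cdot> \<mm>"
    unfolding ideal_prod_assoc[OF I(1) max_pow max_ideal] using n by simp
  have "ideal_pow R \<mm> (n + 1) \<subseteq> colon R (I \<cdot> ideal_pow R \<mm> n \<cdot> \<mm>) \<mm>"
    unfolding eq colon_def using ideal_carrier[OF max_pow[of "n + 1"]] by (auto intro: ideal_prod.prod)
  then show "ideal_pow R \<mm> (n + 1) \<subseteq> I \<cdot> ideal_pow R \<mm> n"
    using weak unfolding weakly_m_full_def by simp
qed

text \<open>The equation holds at the exponent max(r, t) and descends one step at a time to
  t.\<close>

lemma weakly_m_full_reduction: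
  assumes I: "ideal I R" "I \<subseteq> \<mm>"
    and r: "I \<cdot> ideal_pow R \<mm> r = ideal_pow R \<mm> (r + 1)"
    and weak: "\<And>n. t \<le> n \<Longrightarrow> weakly_m_full R \<mm> (I \<cdot> ideal_pow R \<mm> n)"
  shows "I \<cdot> ideal_pow R \<mm> t = ideal_pow R \<mm> (t + 1)"
proof -
  have "t \<le> max r t" by simp
  then show ?thesis
  proof (induction rule: inc_induct)
    case base
    show ?case
      by (rule reduction_step[OF I(1) r]) simp
  next
    case (step n)
    then show ?case
      using weakly_m_full_descend[OF I weak[OF step(1)]] by simp
  qed
qed

section \<open>From positive depth to a non-zero-divisor\<close>

text \<open>Positive depth supplies a nonempty regular sequence in \<mm>. Its first member is a
  non-zero-divisor modulo the ideal generated by the empty set, which is zero, and the cosets of the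
  zero ideal are singletons.\<close>

lemma depth_pos_nzd:
  assumes "depth R \<mm> \<noteq> 0"
  obtains w where "w \<in> \<mm>" "nonzerodivisor R w"
proof -
  have "\<exists>xs. set xs \<subseteq> \<mm> \<and> regular_sequence R xs \<and> xs \<noteq> []"
  proof (rule ccontr)
    assume "\<not> ?thesis"
    then have "depth R \<mm> \<le> 0"
      unfolding depth_def by (intro Sup_least) (auto simp: zero_enat_def)
    then show False
      using assms by simp
  qed
  then obtain x xs where xs: "x \<in> \<mm>" "regular_sequence R (x # xs)"
    by (metis list.set_intros(1) neq_Nil_conv subsetD)
  have zero: "Idl {} = {\<zero>}"
    using genideal_minimal[OF zeroideal, of "{}"] ideal_zero[OF genideal_ideal[of "{}"]] by blast
  have xR: "x \<in> carrier R"
    by (rule ideal_carrier[OF max_ideal xs(1)])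
  have "nonzerodivisor (R Quot (Idl {})) (Idl {} +> x)"
    using xs(2) unfolding regular_sequence_def by force
  then have nzd: "nonzerodivisor (R Quot {\<zero>}) ({\<zero>} +> x)"
    by (simp only: zero)
  have coset: "{\<zero>} +> a = {a}" if "a \<in> carrier R" for a
    using that unfolding a_r_coset_def' by simp
  have "nonzerodivisor R x"
    unfolding nonzerodivisor_def
  proof (intro conjI ballI impI)
    fix y
    assume y: "y \<in> carrier R" "x \<otimes> y = \<zero>"
    have "({\<zero>} +> x) \<otimes>\<^bsub>R Quot {\<zero>}\<^esub> ({\<zero>} +> y) = {\<zero>} +> (x \<otimes> y)"
      unfolding FactRing_def using ideal.rcoset_mult_add[OF zeroideal xR y(1)] by simp
    also have "\<dots> = \<zero>\<^bsub>R Quot {\<zero>}\<^esub>"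
      unfolding y(2) coset[OF zero_closed] by (simp add: FactRing_def)
    finally have eq: "({\<zero>} +> x) \<otimes>\<^bsub>R Quot {\<zero>}\<^esub> ({\<zero>} +> y) = \<zero>\<^bsub>R Quot {\<zero>}\<^esub>" .
    have "{\<zero>} +> y \<in> carrier (R Quot {\<zero>})"
      unfolding FactRing_def A_RCOSETS_def' using y(1) by auto
    then have "{\<zero>} +> y = \<zero>\<^bsub>R Quot {\<zero>}\<^esub>"
      using nzd eq unfolding nonzerodivisor_def by blast
    then show "y = \<zero>"
      unfolding coset[OF y(1)] by (simp add: FactRing_def)
  qed fact
  then show ?thesis
    using that xs(1) by blast
qed

end

theorem corollary3p7:
  fixes R :: "('a, 'b) ring_scheme" and \<mm> I :: "'a set"
  assumes "cohen_macaulay_local_ring R \<mm>"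
    and "krull_dim R = 1"
    and "infinite_residue_field R \<mm>"
    and "minimal_reduction R \<mm> I"
  shows "n2 R \<mm> I \<le> n3 R \<mm> I \<and> n3 R \<mm> I = n1 R \<mm> I \<and> n1 R \<mm> I = reduction_number R \<mm>"
proof -
  have cm: "noetherian_local_ring R \<mm>" "depth R \<mm> = krull_dim R"
    using assms(1) unfolding cohen_macaulay_local_ring_def by simp_all
  interpret noetherian_local_ring R \<mm>
    by (rule cm(1))
  have dim: "krull_dim R \<le> 1"
    using assms(2) by simp
  have "depth R \<mm> \<noteq> 0"
    using cm(2) assms(2) by simp
  then obtain w where w: "nonzerodivisor R w" "w \<in> \<mm>"
    using depth_pos_nzd by blast
  obtain x where x: "nonzerodivisor R x" "x \<in> \<mm>" and Ix: "I = PIdl\<^bsub>R\<^esub> x"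
    and red: "reduction R \<mm> I"
    using minimal_reduction_principal[OF dim w assms(3,4)] by metis
  have I: "ideal I R" "I \<subseteq> \<mm>"
    using red unfolding reduction_def by blast+
  let ?J = "\<lambda>n. I \<cdot>\<^bsub>R\<^esub> ideal_pow R \<mm> n"
  have J: "ideal (?J n) R" for n
    by (rule ideal_prod_is_ideal[OF I(1) max_pow])
  define r where "r = reduction_number_wrt R \<mm> I"
  have "\<exists>k. ?J k = ideal_pow R \<mm> (k + 1)"
    using red unfolding reduction_def by blast
  then have r: "?J r = ideal_pow R \<mm> (r + 1)"
    unfolding r_def reduction_number_wrt_def by (rule LeastI_ex)
  have r_le: "r \<le> k" if "?J k = ideal_pow R \<mm> (k + 1)" for k
    unfolding r_def reduction_number_wrt_def using that by (rule Least_le)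
  have eq: "(PIdl\<^bsub>R\<^esub> x) \<cdot>\<^bsub>R\<^esub> ideal_pow R \<mm> n = ideal_pow R \<mm> (n + 1)" if "r \<le> n" for n
    using reduction_step[OF I(1) r that] unfolding Ix .
  have m_full: "m_full R \<mm> (?J n)" and full: "full R \<mm> (?J n)" if "r \<le> n" for n
    unfolding Ix using principal_m_full[OF x eq[OF that]] principal_full[OF x eq[OF that]] by blast+
  \<comment> \<open>This is the lower bound for \<open>n3\<close>, and for \<open>n1\<close> as well
    because \<mm>-full implies weakly \<mm>-full; the upper bounds come from
    \<open>m_full\<close>.\<close>
  have bound: "r \<le> t" if "\<forall>n\<ge>t. weakly_m_full R \<mm> (?J n)" for t
    using weakly_m_full_reduction[OF I r, of t] that r_le by blast
  have n1: "n1 R \<mm> I = r"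
    unfolding n1_def
    by (rule Least_equality) (auto intro: m_full bound m_full_imp_weakly_m_full J)
  have n3: "n3 R \<mm> I = r"
    unfolding n3_def
    by (rule Least_equality) (auto intro: m_full bound m_full_imp_weakly_m_full J)
  have n2: "n2 R \<mm> I \<le> r"
    unfolding n2_def by (rule Least_le) (blast intro: full)
  \<comment> \<open>Exponents transfer in both directions between two principal reductions generated
    by non-zero-divisors, so the minimum over all minimal reductions is already attained at
    I.\<close>
  have indep: "reduction_number_wrt R \<mm> K = r" if K: "minimal_reduction R \<mm> K" for K
  proof -
    obtain y where y: "nonzerodivisor R y" "y \<in> \<mm>" "K = PIdl\<^bsub>R\<^esub> y" "reduction R \<mm> (PIdl\<^bsub>R\<^esub> y)"
      using minimal_reduction_principal[OF dim w assms(3) K] by blast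
    have carr: "x \<in> carrier R" "y \<in> carrier R"
      using x(1) y(1) unfolding nonzerodivisor_def by blast+
    have "K \<cdot>\<^bsub>R\<^esub> ideal_pow R \<mm> k = ideal_pow R \<mm> (k + 1) \<longleftrightarrow> ?J k = ideal_pow R \<mm> (k + 1)" for k
      unfolding y(3) Ix
      using reduction_exponent_independent[OF x(1) carr(2) y(4)]
        reduction_exponent_independent[OF y(1) carr(1) red[unfolded Ix]] by blast
    then show ?thesis
      unfolding r_def reduction_number_wrt_def by simp
  qed
  have "reduction_number R \<mm> = r"
    unfolding reduction_number_def
  proof (rule Least_equality)
    show "\<exists>K. minimal_reduction R \<mm> K \<and> r = reduction_number_wrt R \<mm> K"
      using assms(4) r_def by blast
    show "r \<le> k" if "\<exists>K. minimal_reduction R \<mm> K \<and> k = reduction_number_wrt R \<mm> K" for k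
      using that indep by auto
  qed
  then show ?thesis
    using n1 n2 n3 by simp
qed

end
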